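(* Let $w_2>w_1$ and $R=\{(u,w):\ u_1\le u\le u_2,\ w_1\le w\le w_2\}$, and assume $a(u,w)>0$ and $b(u,w)>0$ in $R$. If the problem $$U'(w)=\gamma\,\frac{b(U(w),w)}{a(U(w),w)},\qquad U(w_1)=u_1,\quad U(w_2)=u_2,$$ in the unknowns $\gamma$ (a real number) and $U(w)$, has a unique solution, then also the corresponding functional solution of $$\nabla\cdot(a(u,w)\nabla u)=0\ \text{in }\Omega,\quad u=u_1\ \text{on }\Gamma_1,\quad u=u_2\ \text{on }\Gamma_2,\quad \frac{\partial u}{\partial n}=0\ \text{on }\Gamma_3,$$ $$\nabla\cdot(b(u,w)\nabla w)=0\ \text{in }\Omega,\quad w=w_1\ \text{on }\Gamma_1,\quad w=w_2\ \text{on }\Gamma_2,\quad \frac{\partial w}{\partial n}=0\ \text{on }\Gamma_3$$ is unique in the class of functional solutions.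
   Context: $\Omega$ is an open and bounded subset of $\mathbf{R}^N$ with boundary $\Gamma$ divided into three parts $\Gamma_1,\Gamma_2,\Gamma_3$, and $\partial/\partial n$ is the normal derivative; $u_1,u_2,w_1,w_2$ are constants. The boundary of $\Omega$ is assumed to have a degree of regularity which makes solvable the mixed problem $\Delta z=0$ in $\Omega$, $z=0$ on $\Gamma_1$, $z=1$ on $\Gamma_2$, $\frac{\partial z}{\partial n}=0$ on $\Gamma_3$. A classical solution $(u(\mathbf{x}),w(\mathbf{x}))$ of the system is called functional if a function $U(t)\in C^1([w_1,w_2])$ exists such that $u(\mathbf{x})=U(w(\mathbf{x}))$.
   Formalization: It is also assumed that every connected component of Ω has Γ1 or Γ2 in its closure (otherwise constants on a pure-Neumann component break uniqueness), that a and b are continuous on R, that ∂Ω is C¹ near points of Γ3, and that solutions take values in R. *)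

theory Defs
  imports "HOL-Analysis.Analysis"
begin

definition C1_on :: "'a::real_normed_vector set \<Rightarrow> ('a \<Rightarrow> 'b::real_normed_vector) \<Rightarrow> bool" where
  "C1_on S F \<longleftrightarrow>
     (\<exists>F'. (\<forall>x\<in>S. (F has_derivative blinfun_apply (F' x)) (at x within S)) \<and> continuous_on S F')"

definition divergence :: "(real ^ 'n \<Rightarrow> real ^ 'n) \<Rightarrow> real ^ 'n \<Rightarrow> real" where
  "divergence F x = (\<Sum>i\<in>UNIV. frechet_derivative F (at x) (axis i 1) $ i)"

text \<open>The equation \<open>\<nabla>\<cdot>(k \<nabla>v) = 0\<close> in the classical sense: \<open>v\<close> is \<open>C\<^sup>1\<close> and the flux \<open>k \<nabla>v\<close>
  is a \<open>C\<^sup>1\<close> vector field whose divergence vanishes pointwise. For \<open>C\<^sup>1\<close> positive \<open>k\<close> this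
  forces \<open>v\<close> to be \<open>C\<^sup>2\<close>; stated through the flux, the equation also makes sense for coefficients
  that are only continuous. For \<open>k = 1\<close> it says that \<open>v\<close> is \<open>C\<^sup>2\<close> with \<open>\<Delta>v = \<nabla>\<cdot>\<nabla>v = 0\<close>.\<close>

definition div_grad_eq_0 :: "(real ^ 'n) set \<Rightarrow> (real ^ 'n \<Rightarrow> real) \<Rightarrow> (real ^ 'n \<Rightarrow> real) \<Rightarrow> bool" where
  "div_grad_eq_0 \<Omega> k v \<longleftrightarrow>
     (\<exists>g. (\<forall>x\<in>\<Omega>. GDERIV v x :> g x) \<and> continuous_on \<Omega> g \<and>
          C1_on \<Omega> (\<lambda>x. k x *\<^sub>R g x) \<and>
          (\<forall>x\<in>\<Omega>. divergence (\<lambda>x. k x *\<^sub>R g x) x = 0))"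

text \<open>\<open>\<nu>\<close> is the outward unit normal at the boundary point \<open>x\<close>, where near \<open>x\<close> the boundary is a
  \<open>C\<^sup>1\<close> hypersurface with \<open>\<Omega>\<close> on one side: \<open>\<Omega> = {\<rho> < 0}\<close> near \<open>x\<close> for a \<open>C\<^sup>1\<close> function \<open>\<rho>\<close>
  with nonvanishing gradient \<open>g\<close>.\<close>

definition outward_unit_normal :: "(real ^ 'n) set \<Rightarrow> real ^ 'n \<Rightarrow> real ^ 'n \<Rightarrow> bool" where
  "outward_unit_normal \<Omega> x \<nu> \<longleftrightarrow>
     (\<exists>V \<rho> g. open V \<and> x \<in> V \<and>
        (\<forall>y\<in>V. GDERIV \<rho> y :> g y \<and> g y \<noteq> 0) \<and> continuous_on V g \<and>
        \<Omega> \<inter> V = {y \<in> V. \<rho> y < 0} \<and> x \<in> frontier \<Omega> \<and>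
        \<nu> = (1 / norm (g x)) *\<^sub>R g x)"

text \<open>Normal derivative at a boundary point, as the one-sided derivative along the normal taken from
  inside \<open>\<Omega>\<close>: for small \<open>t < 0\<close> the point \<open>x + t \<nu>\<close> lies in \<open>\<Omega>\<close>.\<close>

definition has_normal_derivative ::
    "(real ^ 'n \<Rightarrow> real) \<Rightarrow> real ^ 'n \<Rightarrow> real ^ 'n \<Rightarrow> real \<Rightarrow> bool" where
  "has_normal_derivative v x \<nu> d \<longleftrightarrow>
     ((\<lambda>t. v (x + t *\<^sub>R \<nu>)) has_real_derivative d) (at_left 0)"

text \<open>Bounded open set with boundary divided into three parts and outward unit normal field \<open>n\<close> on
  \<open>\<Gamma>3\<close>. The set need not be connected. The last condition says that each connected component
  reaches the Dirichlet part of the boundary; for connected \<open>\<Omega>\<close> it only says that \<open>\<Gamma>1\<close> and \<open>\<Gamma>2\<close>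
  are not both empty. On a component violating it, all boundary conditions are of Neumann type and
  arbitrary constants could be added to a solution.\<close>

definition mixed_domain ::
    "(real ^ 'n) set \<Rightarrow> (real ^ 'n) set \<Rightarrow> (real ^ 'n) set \<Rightarrow> (real ^ 'n) set \<Rightarrow>
     (real ^ 'n \<Rightarrow> real ^ 'n) \<Rightarrow> bool" where
  "mixed_domain \<Omega> \<Gamma>1 \<Gamma>2 \<Gamma>3 n \<longleftrightarrow>
     open \<Omega> \<and> bounded \<Omega> \<and>
     frontier \<Omega> = \<Gamma>1 \<union> \<Gamma>2 \<union> \<Gamma>3 \<and>
     \<Gamma>1 \<inter> \<Gamma>2 = {} \<and> \<Gamma>1 \<inter> \<Gamma>3 = {} \<and> \<Gamma>2 \<inter> \<Gamma>3 = {} \<and>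
     (\<forall>x\<in>\<Gamma>3. outward_unit_normal \<Omega> x (n x)) \<and>
     (\<forall>C\<in>components \<Omega>. closure C \<inter> (\<Gamma>1 \<union> \<Gamma>2) \<noteq> {})"

text \<open>Classical solution of \<open>\<nabla>\<cdot>(k \<nabla>v) = 0\<close> in \<open>\<Omega>\<close>, \<open>v = c1\<close> on \<open>\<Gamma>1\<close>, \<open>v = c2\<close> on \<open>\<Gamma>2\<close>,
  \<open>\<partial>v/\<partial>n = 0\<close> on \<open>\<Gamma>3\<close>. Only the values of \<open>v\<close> on \<open>closure \<Omega>\<close> matter.\<close>

definition mixed_solution ::
    "(real ^ 'n) set \<Rightarrow> (real ^ 'n) set \<Rightarrow> (real ^ 'n) set \<Rightarrow> (real ^ 'n) set \<Rightarrow>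
     (real ^ 'n \<Rightarrow> real ^ 'n) \<Rightarrow> (real ^ 'n \<Rightarrow> real) \<Rightarrow> real \<Rightarrow> real \<Rightarrow> (real ^ 'n \<Rightarrow> real) \<Rightarrow> bool" where
  "mixed_solution \<Omega> \<Gamma>1 \<Gamma>2 \<Gamma>3 n k c1 c2 v \<longleftrightarrow>
     continuous_on (closure \<Omega>) v \<and> div_grad_eq_0 \<Omega> k v \<and>
     (\<forall>x\<in>\<Gamma>1. v x = c1) \<and> (\<forall>x\<in>\<Gamma>2. v x = c2) \<and>
     (\<forall>x\<in>\<Gamma>3. has_normal_derivative v x (n x) 0)"

text \<open>The coefficients are only prescribed on the rectangle \<open>R = {u1..u2} \<times> {w1..w2}\<close>, so a solution
  of the system takes its values there.\<close>

definition classical_solution ::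
    "(real ^ 'n) set \<Rightarrow> (real ^ 'n) set \<Rightarrow> (real ^ 'n) set \<Rightarrow> (real ^ 'n) set \<Rightarrow>
     (real ^ 'n \<Rightarrow> real ^ 'n) \<Rightarrow> (real \<Rightarrow> real \<Rightarrow> real) \<Rightarrow> (real \<Rightarrow> real \<Rightarrow> real) \<Rightarrow>
     real \<Rightarrow> real \<Rightarrow> real \<Rightarrow> real \<Rightarrow> (real ^ 'n \<Rightarrow> real) \<Rightarrow> (real ^ 'n \<Rightarrow> real) \<Rightarrow> bool" where
  "classical_solution \<Omega> \<Gamma>1 \<Gamma>2 \<Gamma>3 n a b u1 u2 w1 w2 u w \<longleftrightarrow>
     (\<forall>x\<in>closure \<Omega>. (u x, w x) \<in> {u1..u2} \<times> {w1..w2}) \<and>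
     mixed_solution \<Omega> \<Gamma>1 \<Gamma>2 \<Gamma>3 n (\<lambda>x. a (u x) (w x)) u1 u2 u \<and>
     mixed_solution \<Omega> \<Gamma>1 \<Gamma>2 \<Gamma>3 n (\<lambda>x. b (u x) (w x)) w1 w2 w"

definition functional_solution ::
    "(real ^ 'n) set \<Rightarrow> (real ^ 'n) set \<Rightarrow> (real ^ 'n) set \<Rightarrow> (real ^ 'n) set \<Rightarrow>
     (real ^ 'n \<Rightarrow> real ^ 'n) \<Rightarrow> (real \<Rightarrow> real \<Rightarrow> real) \<Rightarrow> (real \<Rightarrow> real \<Rightarrow> real) \<Rightarrow>
     real \<Rightarrow> real \<Rightarrow> real \<Rightarrow> real \<Rightarrow> (real ^ 'n \<Rightarrow> real) \<Rightarrow> (real ^ 'n \<Rightarrow> real) \<Rightarrow> bool" where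
  "functional_solution \<Omega> \<Gamma>1 \<Gamma>2 \<Gamma>3 n a b u1 u2 w1 w2 u w \<longleftrightarrow>
     classical_solution \<Omega> \<Gamma>1 \<Gamma>2 \<Gamma>3 n a b u1 u2 w1 w2 u w \<and>
     (\<exists>U. C1_on {w1..w2} U \<and> (\<forall>x\<in>closure \<Omega>. u x = U (w x)))"

text \<open>For continuous \<open>a\<close>, \<open>b\<close>, positive on \<open>R\<close>, such a \<open>U\<close> is automatically \<open>C\<^sup>1\<close> on \<open>{w1..w2}\<close>.\<close>

definition two_point_solution ::
    "(real \<Rightarrow> real \<Rightarrow> real) \<Rightarrow> (real \<Rightarrow> real \<Rightarrow> real) \<Rightarrow> real \<Rightarrow> real \<Rightarrow> real \<Rightarrow> real \<Rightarrow>
     real \<Rightarrow> (real \<Rightarrow> real) \<Rightarrow> bool" where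
  "two_point_solution a b u1 u2 w1 w2 \<gamma> U \<longleftrightarrow>
     (\<forall>w\<in>{w1..w2}. (U w, w) \<in> {u1..u2} \<times> {w1..w2}) \<and>
     (\<forall>w\<in>{w1..w2}.
        (U has_real_derivative \<gamma> * (b (U w) w / a (U w) w)) (at w within {w1..w2})) \<and>
     U w1 = u1 \<and> U w2 = u2"

end

theory Submission
  imports Defs
begin

text \<open>For a functional solution \<open>u = V(w)\<close>, the functions \<open>\<integral>b(V(w),w) dw\<close> and \<open>\<integral>a(V(w),w) V'(w) dw\<close>
  of \<open>w\<close> are harmonic with constant data on \<open>\<Gamma>1\<close> and \<open>\<Gamma>2\<close> and zero normal derivative on \<open>\<Gamma>3\<close>, so by
  uniqueness for the mixed problem both are multiples of \<open>z\<close>. Hence they are proportional, which is the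
  two-point problem for \<open>V\<close> on the range of \<open>w\<close>. Either \<open>z\<close> takes all values in \<open>(0,1)\<close>, and then
  \<open>w\<close> takes all values in \<open>{w1..w2}\<close> and \<open>V = U\<close>; or \<open>z\<close> takes only the values \<open>0\<close> and \<open>1\<close>, and
  then \<open>(u,w)\<close> takes only the values \<open>(u1,w1)\<close> and \<open>(u2,w2)\<close>. Conversely \<open>w\<close> is obtained from \<open>z\<close> by
  inverting \<open>\<integral>b(U(w),w) dw\<close>. Uniqueness for the mixed problem rests on the maximum principle, where the
  boundary is only \<open>C\<^sup>1\<close> at \<open>\<Gamma>3\<close> and the normal derivative exists only pointwise.\<close>

section \<open>Quadratic barriers\<close>

lemma divergence_eq:
  assumes "(F has_derivative F') (at x)"
  shows "divergence F x = (\<Sum>i\<in>UNIV. F' (axis i 1) $ i)"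
  using frechet_derivative_at[OF assms] by (simp add: divergence_def)

lemma divergence_add:
  assumes "F differentiable (at x)" "G differentiable (at x)"
  shows "divergence (\<lambda>y. F y + G y) x = divergence F x + divergence G x"
proof -
  obtain F' G' where F: "(F has_derivative F') (at x)" and G: "(G has_derivative G') (at x)"
    using assms by (auto simp: differentiable_def)
  show ?thesis
    by (simp add: divergence_eq[OF F] divergence_eq[OF G] divergence_eq[OF has_derivative_add[OF F G]]
        sum.distrib)
qed

lemma divergence_scaleR:
  assumes "F differentiable (at x)"
  shows "divergence (\<lambda>y. c *\<^sub>R F y) x = c * divergence F x"
proof -
  obtain F' where F: "(F has_derivative F') (at x)"
    using assms by (auto simp: differentiable_def)
  show ?thesis
    by (simp add: divergence_eq[OF F] divergence_eq[OF has_derivative_scaleR_right[OF F]]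
        sum_distrib_left)
qed

lemma GDERIV_line:
  assumes "GDERIV f (x + s *\<^sub>R d) :> g"
  shows "((\<lambda>s. f (x + s *\<^sub>R d)) has_real_derivative d \<bullet> g) (at s within S)"
proof -
  have "((\<lambda>s. x + s *\<^sub>R d) has_derivative (\<lambda>s. s *\<^sub>R d)) (at s within S)"
    by (auto intro!: derivative_eq_intros)
  from has_derivative_compose[OF this assms[unfolded gderiv_def]]
  show ?thesis
    by (rule has_derivative_imp_has_field_derivative) simp
qed

text \<open>Second-derivative test, one coordinate axis at a time: the divergence is the sum of the
  pure second derivatives. If one of them were negative, the slope along that axis, which vanishes
  at \<open>q\<close>, would be negative just to the right of \<open>q\<close>, and \<open>f\<close>
  would drop below its minimum.\<close>

lemma divergence_gradient_nonneg_at_min: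
  fixes f :: "real ^ 'n \<Rightarrow> real"
  assumes "open S" "q \<in> S" and grad: "\<And>x. x \<in> S \<Longrightarrow> GDERIV f x :> G x"
    and "G differentiable (at q)" and min: "\<And>y. y \<in> S \<Longrightarrow> f q \<le> f y"
  shows "0 \<le> divergence G q"
proof -
  obtain G' where G': "(G has_derivative G') (at q)"
    using assms(4) by (auto simp: differentiable_def)
  obtain r where "r > 0" and r: "ball q r \<subseteq> S"
    using assms(1,2) openE by blast
  have "0 \<le> G' (axis i 1) $ i" for i
  proof (rule ccontr)
    assume neg: "\<not> 0 \<le> G' (axis i 1) $ i"
    let ?d = "axis i 1 :: real ^ 'n"
    let ?\<phi> = "\<lambda>s. f (q + s *\<^sub>R ?d)"
    let ?\<psi> = "\<lambda>s. ?d \<bullet> G (q + s *\<^sub>R ?d)"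
    have in_S: "q + s *\<^sub>R ?d \<in> S" if "\<bar>s\<bar> < r" for s
      using that r by (auto simp: dist_norm subset_iff)
    have \<phi>': "(?\<phi> has_real_derivative ?\<psi> s) (at s)" if "\<bar>s\<bar> < r" for s
      by (rule GDERIV_line[OF grad[OF in_S[OF that]]])
    have "?\<psi> 0 = 0"
      by (rule DERIV_local_min[OF \<phi>' \<open>r > 0\<close>]) (use \<open>r > 0\<close> in_S min in auto)
    moreover have "((\<lambda>s. q + s *\<^sub>R ?d) has_derivative (\<lambda>s. s *\<^sub>R ?d)) (at 0)"
      by (auto intro!: derivative_eq_intros)
    then have "((\<lambda>s. G (q + s *\<^sub>R ?d)) has_derivative (\<lambda>s. G' (s *\<^sub>R ?d))) (at 0)"
      by (rule has_derivative_compose) (use G' in simp)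
    then have "(?\<psi> has_derivative (\<lambda>s. ?d \<bullet> G' (s *\<^sub>R ?d))) (at 0)"
      by (rule has_derivative_inner_right)
    then have "(?\<psi> has_real_derivative G' ?d $ i) (at 0)"
      by (rule has_derivative_imp_has_field_derivative)
         (simp add: linear_scale[OF has_derivative_linear[OF G']] inner_axis')
    ultimately obtain e where "e > 0" and e: "\<And>h. h > 0 \<Longrightarrow> h < e \<Longrightarrow> ?\<psi> h < 0"
      using DERIV_neg_dec_right[of ?\<psi> "G' ?d $ i" 0] neg by auto
    define s where "s = min e r / 2"
    have s: "0 < s" "s < e" "s < r"
      using \<open>e > 0\<close> \<open>r > 0\<close> by (auto simp: s_def min_def)
    have "?\<phi> s < ?\<phi> 0"
    proof (rule DERIV_neg_imp_decreasing_open[OF s(1)])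
      show "\<exists>y. (?\<phi> has_real_derivative y) (at x) \<and> y < 0" if "0 < x" "x < s" for x
        using \<phi>'[of x] e[of x] that s by auto
      show "continuous_on {0..s} ?\<phi>"
        by (rule DERIV_continuous_on[where D="?\<psi>"], rule DERIV_subset[OF \<phi>'])
           (use s in auto)
    qed
    then show False
      using min[OF in_S[of s]] s by simp
  qed
  then show ?thesis
    by (auto simp: divergence_eq[OF G'] intro: sum_nonneg)
qed

text \<open>A quadratic vanishing at \<open>p\<close> with gradient \<open>- e\<close> there. The
  \<open>A\<close> term makes it strictly subharmonic, while the \<open>k\<close> term pushes it
  below zero away from \<open>p\<close> in directions orthogonal to \<open>e\<close>.\<close>

definition barrier :: "real ^ 'n \<Rightarrow> real ^ 'n \<Rightarrow> real \<Rightarrow> real \<Rightarrow> real ^ 'n \<Rightarrow> real" where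
  "barrier p e A k x = A * ((x - p) \<bullet> e)\<^sup>2 - k * ((x - p) \<bullet> (x - p)) - (x - p) \<bullet> e"

definition barrier_grad :: "real ^ 'n \<Rightarrow> real ^ 'n \<Rightarrow> real \<Rightarrow> real \<Rightarrow> real ^ 'n \<Rightarrow> real ^ 'n" where
  "barrier_grad p e A k x = (2 * A * ((x - p) \<bullet> e) - 1) *\<^sub>R e - (2 * k) *\<^sub>R (x - p)"

lemma GDERIV_barrier: "GDERIV (barrier p e A k) x :> barrier_grad p e A k x"
  unfolding gderiv_def barrier_def[abs_def] barrier_grad_def power2_eq_square
  by (rule derivative_eq_intros refl)+
     (auto simp: fun_eq_iff inner_simps algebra_simps inner_commute)

lemma continuous_on_barrier: "continuous_on S (barrier p e A k)"
  unfolding barrier_def[abs_def] by (intro continuous_intros)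

lemma has_derivative_barrier_grad:
  "(barrier_grad p e A k has_derivative (\<lambda>h. (2 * A * (h \<bullet> e)) *\<^sub>R e - (2 * k) *\<^sub>R h)) (at x)"
  unfolding barrier_grad_def[abs_def]
  by (rule derivative_eq_intros refl)+ (auto simp: fun_eq_iff)

lemma divergence_barrier_grad:
  fixes p e :: "real ^ 'n"
  assumes "norm e = 1"
  shows "divergence (barrier_grad p e A k) x = 2 * A - 2 * k * CARD('n)"
proof -
  have "(\<Sum>i\<in>UNIV. e $ i * e $ i) = 1"
    using assms by (simp add: norm_eq_1 inner_vec_def)
  moreover have "(\<Sum>i\<in>UNIV. 2 * A * (e $ i) * e $ i) = 2 * A * (\<Sum>i\<in>UNIV. e $ i * e $ i)"
    by (simp add: sum_distrib_left mult.assoc)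
  ultimately show ?thesis
    by (simp add: divergence_eq[OF has_derivative_barrier_grad] inner_axis' sum_subtractf)
qed

text \<open>Adding the barrier turns Laplacian zero into the positive number
  \<open>\<epsilon> * (2 * A - 2 * k * CARD('n))\<close>, which the second-derivative test forbids
  at a maximum. The test is stated for minima, so it is applied to the negative.\<close>

lemma no_interior_max_with_barrier:
  fixes v :: "real ^ 'n \<Rightarrow> real" and A k :: real
  assumes "open S" "q \<in> S" and grad: "\<And>x. x \<in> S \<Longrightarrow> GDERIV v x :> g x"
    and g: "g differentiable (at q)" "divergence g q = 0"
    and "norm e = 1" "0 < \<epsilon>" "k * CARD('n) < A"
  shows "\<exists>y\<in>S. v q + \<epsilon> * barrier p e A k q < v y + \<epsilon> * barrier p e A k y"
proof (rule ccontr)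
  assume "\<not> ?thesis"
  then have max: "- (v q + \<epsilon> * barrier p e A k q) \<le> - (v y + \<epsilon> * barrier p e A k y)" if "y \<in> S" for y
    using that by (auto simp: not_less)
  let ?G = "\<lambda>x. (-1) *\<^sub>R (g x + \<epsilon> *\<^sub>R barrier_grad p e A k x)"
  have b: "barrier_grad p e A k differentiable (at q)"
    using has_derivative_barrier_grad differentiable_def by blast
  then have eb: "(\<lambda>x. \<epsilon> *\<^sub>R barrier_grad p e A k x) differentiable (at q)"
    by (intro derivative_intros)
  have "0 \<le> divergence ?G q"
  proof (rule divergence_gradient_nonneg_at_min[OF assms(1,2), where f="\<lambda>x. - (v x + \<epsilon> * barrier p e A k x)"])
    show "GDERIV (\<lambda>x. - (v x + \<epsilon> * barrier p e A k x)) x :> ?G x" if "x \<in> S" for x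
      using GDERIV_minus[OF GDERIV_add[OF grad[OF that]
          GDERIV_mult[OF GDERIV_const[of \<epsilon>] GDERIV_barrier[of p e A k x]]]] by simp
    show "?G differentiable (at q)"
      by (rule differentiable_scaleR[OF differentiable_const differentiable_add[OF g(1) eb]])
  qed (fact max)
  also have "divergence ?G q = - \<epsilon> * (2 * A - 2 * k * CARD('n))"
    unfolding divergence_scaleR[OF differentiable_add[OF g(1) eb]] divergence_add[OF g(1) eb]
      divergence_scaleR[OF b] divergence_barrier_grad[OF assms(6)] g(2) by simp
  finally show False
    using assms(7,8) by (simp add: zero_le_mult_iff mult_le_0_iff)
qed

text \<open>On the part \<open>T\<close> of the boundary where \<open>v\<close> has room below its maximum or the barrier is
  negative, the perturbed function cannot be maximal; on \<open>D\<close> it is strictly subharmonic. So its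
  maximum is pushed to the rest of the boundary.\<close>

lemma max_with_barrier:
  fixes v :: "real ^ 'n \<Rightarrow> real" and A k :: real
  assumes K: "compact K" "continuous_on K v" and D: "open D" "D \<subseteq> K"
    and grad: "\<And>x. x \<in> D \<Longrightarrow> GDERIV v x :> g x"
    and g: "\<And>x. x \<in> D \<Longrightarrow> g differentiable (at x)" "\<And>x. x \<in> D \<Longrightarrow> divergence g x = 0"
    and p: "p \<in> K" "v p = M" and le: "\<And>x. x \<in> K \<Longrightarrow> v x \<le> M"
    and "closed T" and outer: "\<And>x. x \<in> K \<inter> T \<Longrightarrow> 0 \<le> barrier p e A k x \<Longrightarrow> v x < M"
    and e: "norm e = 1" and A: "k * CARD('n) < A"
  obtains \<epsilon> q where "0 < \<epsilon>" "q \<in> K" "q \<notin> D" "q \<notin> T"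
    "\<And>y. y \<in> K \<Longrightarrow> v y + \<epsilon> * barrier p e A k y \<le> v q + \<epsilon> * barrier p e A k q"
    "M \<le> v q + \<epsilon> * barrier p e A k q"
proof -
  let ?b = "barrier p e A k"
  let ?L = "(K \<inter> T) \<inter> (?b -` {0..})"
  have bc: "continuous_on S ?b" for S by (rule continuous_on_barrier)
  have bp: "?b p = 0" by (simp add: barrier_def)
  have "compact ?L"
  proof -
    have "closed (?b -` {0..})"
      by (rule closed_vimage[OF _ bc]) simp
    then show ?thesis using K(1) \<open>closed T\<close> by (intro compact_Int_closed) auto
  qed
  \<comment> \<open>On the compact set \<open>?L\<close>, where the barrier may raise the value,
    \<open>v\<close> stays below \<open>M\<close> by a fixed margin, which a small multiple of the
    bounded barrier cannot use up.\<close>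
  have "\<exists>\<epsilon>>0. \<forall>x\<in>?L. v x + \<epsilon> * ?b x < M"
  proof (cases "?L = {}")
    case True then show ?thesis by (auto intro: exI[of _ 1])
  next
    case False
    obtain x0 where x0: "x0 \<in> ?L" "\<And>x. x \<in> ?L \<Longrightarrow> v x \<le> v x0"
      using continuous_attains_sup[OF \<open>compact ?L\<close> False, of v] continuous_on_subset[OF K(2), of ?L]
      by blast
    obtain x1 where x1: "x1 \<in> ?L" "\<And>x. x \<in> ?L \<Longrightarrow> ?b x \<le> ?b x1"
      using continuous_attains_sup[OF \<open>compact ?L\<close> False bc] by metis
    have lt: "v x0 < M" using outer[of x0] x0(1) by auto
    have b1: "0 \<le> ?b x1" using x1(1) by auto
    \<comment> \<open>The summand 1 covers \<open>?b x1 = 0\<close> and makes the estimate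
      strict.\<close>
    define \<epsilon> where "\<epsilon> = (M - v x0) / (?b x1 + 1)"
    have "\<epsilon> > 0" using lt b1 by (simp add: \<epsilon>_def)
    moreover have "v x + \<epsilon> * ?b x < M" if "x \<in> ?L" for x
    proof -
      have "\<epsilon> * ?b x \<le> \<epsilon> * ?b x1" using x1(2)[OF that] \<open>\<epsilon> > 0\<close> by simp
      also have "\<dots> < \<epsilon> * (?b x1 + 1)" using \<open>\<epsilon> > 0\<close> by simp
      also have "\<dots> = M - v x0" using b1 by (simp add: \<epsilon>_def)
      finally show ?thesis using x0(2)[OF that] by simp
    qed
    ultimately show ?thesis by blast
  qed
  then obtain \<epsilon> where \<epsilon>: "\<epsilon> > 0" and small: "\<And>x. x \<in> ?L \<Longrightarrow> v x + \<epsilon> * ?b x < M" by blast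
  have "continuous_on K (\<lambda>x. v x + \<epsilon> * ?b x)"
    by (intro continuous_intros K bc)
  then obtain q where q: "q \<in> K" and max: "\<And>y. y \<in> K \<Longrightarrow> v y + \<epsilon> * ?b y \<le> v q + \<epsilon> * ?b q"
    using continuous_attains_sup[OF K(1), of "\<lambda>x. v x + \<epsilon> * ?b x"] p(1) by blast
  \<comment> \<open>Comparison with \<open>p\<close>, where the barrier vanishes. On
    \<open>T\<close> the perturbed value is below \<open>M\<close>: by the choice of
    \<open>\<epsilon>\<close> where the barrier is nonnegative, by \<open>v \<le> M\<close> where it
    is negative.\<close>
  have M: "M \<le> v q + \<epsilon> * ?b q" using max[OF p(1)] p(2) bp by simp
  have "q \<notin> T"
  proof
    assume "q \<in> T"
    show False
    proof (cases "0 \<le> ?b q")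
      case True then show False using small[of q] \<open>q \<in> T\<close> q M by simp
    next
      case False
      then have "\<epsilon> * ?b q < 0" using \<epsilon> by (simp add: mult_pos_neg)
      then show False using M le[OF q] by simp
    qed
  qed
  moreover have "q \<notin> D"
  proof
    assume "q \<in> D"
    from no_interior_max_with_barrier[OF D(1) this grad g(1)[OF this] g(2)[OF this] e \<epsilon> A, of p]
    show False using max D(2) by (auto simp: not_less[symmetric])
  qed
  ultimately show ?thesis using that \<epsilon> q max M by blast
qed

section \<open>Strong maximum principle\<close>

text \<open>Hopf's boundary point lemma for a ball. The barrier is nonpositive on the sphere near
  \<open>p\<close>, so the perturbed function is maximal at \<open>p\<close>; but its gradient there
  is \<open>- \<epsilon>\<close> times the outward normal \<open>e\<close>, so it grows on moving
  inwards.\<close>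

lemma no_max_on_ball_boundary_with_zero_gradient:
  fixes v :: "real ^ 'n \<Rightarrow> real"
  assumes "0 < r" and cont: "continuous_on (cball y r) v"
    and grad: "\<And>x. x \<in> ball y r \<Longrightarrow> GDERIV v x :> g x"
    and g: "\<And>x. x \<in> ball y r \<Longrightarrow> g differentiable (at x)" "\<And>x. x \<in> ball y r \<Longrightarrow> divergence g x = 0"
    and p: "dist y p = r" "GDERIV v p :> 0"
    and le: "\<And>x. x \<in> cball y r \<Longrightarrow> v x \<le> v p" and less: "\<And>x. x \<in> ball y r \<Longrightarrow> v x < v p"
  shows False
proof -
  define e where "e = (1 / r) *\<^sub>R (p - y)"
  have e: "norm e = 1" using p(1) \<open>0 < r\<close> by (simp add: e_def dist_norm norm_minus_commute)
  then have ee: "e \<bullet> e = 1" by (simp add: norm_eq_1)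
  have py: "p - y = r *\<^sub>R e" using \<open>0 < r\<close> by (simp add: e_def)
  \<comment> \<open>\<open>N\<close> exceeds the dimension, so \<open>A = N / r\<close> is large
    enough for the coefficient \<open>1 / r\<close> used in the barrier; \<open>\<delta>\<close> is
    the radius with \<open>A * \<delta> = 1 / 2\<close>.\<close>
  define N where "N = real CARD('n) + 1"
  have N: "N \<ge> 1" by (simp add: N_def)
  define A where "A = N / r"
  define \<delta> where "\<delta> = r / (2 * N)"
  have pos: "0 < A" "0 < \<delta>" "A * \<delta> = 1 / 2" "\<delta> \<le> r"
    using \<open>0 < r\<close> N by (auto simp: A_def \<delta>_def field_simps)
  have A: "1 / r * CARD('n) < A" using \<open>0 < r\<close> by (simp add: A_def N_def divide_strict_right_mono)
  let ?b = "barrier p e A (1 / r)"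
  \<comment> \<open>The sphere equation reads \<open>X \<bullet> X = - 2 * r * t\<close>. With
    coefficient \<open>1 / r\<close> the barrier then collapses to \<open>t * (1 + A * t)\<close>,
    where \<open>t \<le> 0\<close> and the second factor is positive.\<close>
  have sphere: "?b x \<le> 0 \<and> (?b x = 0 \<longrightarrow> x = p)" if "dist y x = r" "dist p x \<le> \<delta>" for x
  proof -
    define X where "X = x - p"
    define t where "t = X \<bullet> e"
    have "x - y = X + r *\<^sub>R e" using py by (simp add: X_def algebra_simps)
    then have "(X + r *\<^sub>R e) \<bullet> (X + r *\<^sub>R e) = r\<^sup>2"
      using that(1) by (metis dist_commute dist_norm dot_square_norm)
    then have "X \<bullet> X + 2 * r * t = 0"
      using ee by (simp add: inner_simps t_def power2_eq_square inner_commute algebra_simps)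
    then have XX: "X \<bullet> X = - 2 * r * t" by simp
    then have t: "t \<le> 0"
      using \<open>0 < r\<close> inner_ge_zero[of X] by (simp add: mult_le_0_iff)
    have "\<bar>t\<bar> \<le> norm X"
      using Cauchy_Schwarz_ineq2[of X e] e by (simp add: t_def)
    also have "\<dots> \<le> \<delta>"
      using that(2) by (simp add: X_def dist_norm norm_minus_commute)
    finally have "A * \<bar>t\<bar> \<le> 1 / 2"
      using pos(1,3) mult_left_mono[of "\<bar>t\<bar>" \<delta> A] by linarith
    then have f: "1 + A * t > 0" using t by simp
    have "?b x = A * t\<^sup>2 - 1 / r * (X \<bullet> X) - t"
      by (simp add: barrier_def X_def t_def)
    also have "\<dots> = t * (1 + A * t)"
      using \<open>0 < r\<close> by (simp add: XX power2_eq_square algebra_simps)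
    finally have b: "?b x = t * (1 + A * t)" .
    have "t = 0 \<Longrightarrow> x = p" using XX by (simp add: X_def)
    then show ?thesis
      using b f t by (auto simp: mult_le_0_iff)
  qed
  obtain \<epsilon> q where \<epsilon>: "0 < \<epsilon>" and q: "q \<in> cball y r \<inter> cball p \<delta>" "q \<notin> ball y r \<inter> ball p \<delta>" "q \<notin> sphere p \<delta>"
    and max: "\<And>x. x \<in> cball y r \<inter> cball p \<delta> \<Longrightarrow> v x + \<epsilon> * ?b x \<le> v q + \<epsilon> * ?b q"
    and "v p \<le> v q + \<epsilon> * ?b q"
  proof (rule max_with_barrier[where D="ball y r \<inter> ball p \<delta>" and K="cball y r \<inter> cball p \<delta>"
        and T="sphere p \<delta>" and p=p and v=v and g=g and M="v p" and e=e and A=A and k="1/r"])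
    show "compact (cball y r \<inter> cball p \<delta>)" by (intro compact_Int compact_cball)
    show "continuous_on (cball y r \<inter> cball p \<delta>) v" using cont continuous_on_subset by blast
    show "open (ball y r \<inter> ball p \<delta>)" by auto
    show "ball y r \<inter> ball p \<delta> \<subseteq> cball y r \<inter> cball p \<delta>" by auto
    show "v x < v p" if "x \<in> cball y r \<inter> cball p \<delta> \<inter> sphere p \<delta>" "0 \<le> ?b x" for x
    proof -
      have "dist y x \<noteq> r"
        using sphere[of x] that pos by auto
      then show ?thesis using less that by auto
    qed
  qed (use grad g p pos le e A in auto)
  \<comment> \<open>Excluded from the open lens and from the outer sphere, \<open>q\<close> must lie
    on the sphere about \<open>y\<close>.\<close>
  have "?b q \<le> 0" using sphere[of q] q by auto
  then have "\<epsilon> * ?b q \<le> 0" using \<epsilon> by (simp add: mult_le_0_iff)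
  then have maxp: "v x + \<epsilon> * ?b x \<le> v p" if "x \<in> cball y r \<inter> cball p \<delta>" for x
    using max[OF that] le[of q] q by auto
  let ?f = "\<lambda>s. v (p + s *\<^sub>R e) + \<epsilon> * ?b (p + s *\<^sub>R e)"
  have "GDERIV (\<lambda>x. v x + \<epsilon> * ?b x) p :> \<epsilon> *\<^sub>R (- e)"
    using GDERIV_add[OF p(2) GDERIV_mult[OF GDERIV_const[of \<epsilon>] GDERIV_barrier[of p e A "1/r" p]]]
    by (simp add: barrier_grad_def)
  then have "(?f has_real_derivative e \<bullet> (\<epsilon> *\<^sub>R (- e))) (at 0)"
    by (intro GDERIV_line) simp
  moreover have "e \<bullet> (\<epsilon> *\<^sub>R (- e)) < 0" using ee \<epsilon> by simp
  ultimately obtain d where "0 < d" and d: "\<And>h. 0 < h \<Longrightarrow> h < d \<Longrightarrow> ?f 0 < ?f (0 - h)"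
    using DERIV_neg_dec_left[of ?f _ 0] by blast
  define h where "h = min d \<delta> / 2"
  have h: "0 < h" "h < d" "h \<le> \<delta>" using \<open>0 < d\<close> pos by (auto simp: h_def)
  have "y - (p - h *\<^sub>R e) = (h - r) *\<^sub>R e" using py by (simp add: algebra_simps)
  then have "p - h *\<^sub>R e \<in> cball y r \<inter> cball p \<delta>"
    using e h pos by (auto simp: dist_norm)
  from maxp[OF this] d[OF h(1,2)] show False
    by (simp add: barrier_def)
qed

text \<open>The set where \<open>v\<close> attains \<open>M\<close> is relatively closed, and it is
  also open: otherwise the ball about some nearby \<open>y\<close> reaching to the nearest maximum
  point \<open>p'\<close> contains no maximum point inside, while the gradient at \<open>p'\<close>
  vanishes because \<open>p'\<close> is an interior maximum. This contradicts the Hopf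
  lemma.\<close>

lemma harmonic_interior_max_constant:
  fixes v :: "real ^ 'n \<Rightarrow> real"
  assumes "open S" "connected S"
    and grad: "\<And>x. x \<in> S \<Longrightarrow> GDERIV v x :> g x"
    and g: "\<And>x. x \<in> S \<Longrightarrow> g differentiable (at x)" "\<And>x. x \<in> S \<Longrightarrow> divergence g x = 0"
    and le: "\<And>x. x \<in> S \<Longrightarrow> v x \<le> M" and x0: "x0 \<in> S" "v x0 = M" and "x \<in> S"
  shows "v x = M"
proof -
  have cont: "continuous_on S v"
    using grad by (intro continuous_at_imp_continuous_on ballI)
      (metis gderiv_def has_derivative_continuous)
  have grad0: "GDERIV v p :> 0" if p: "p \<in> S" "v p = M" for p
  proof -
    obtain s where s: "s > 0" "ball p s \<subseteq> S" using p(1) \<open>open S\<close> openE by blast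
    have "(\<lambda>h. h \<bullet> g p) = (\<lambda>h. 0)"
      using differential_zero_maxmin[of p "ball p s" v "\<lambda>h. h \<bullet> g p"] s grad[OF p(1)] le p
      by (auto simp: gderiv_def)
    then show ?thesis using grad[OF p(1)] by (simp add: gderiv_def)
  qed
  have "\<exists>\<rho>>0. ball p \<rho> \<subseteq> {z \<in> S. v z = M}" if p: "p \<in> S" "v p = M" for p
  proof -
    \<comment> \<open>Twice the radius leaves room: for \<open>y\<close> within \<open>R\<close> of
      \<open>p\<close> the nearest maximum point is closer than \<open>R\<close>, so the ball about
      \<open>y\<close> up to that point stays in \<open>S\<close>.\<close>
    obtain R where R: "R > 0" "cball p (2 * R) \<subseteq> S"
    proof -
      obtain R0 where "R0 > 0" "cball p R0 \<subseteq> S" using p(1) \<open>open S\<close> open_contains_cball by blast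
      then show ?thesis using that[of "R0 / 2"] by simp
    qed
    have "v y = M" if y: "y \<in> ball p R" for y
    proof (rule ccontr)
      assume neq: "v y \<noteq> M"
      let ?Z = "{z \<in> cball p (2 * R). v z = M}"
      have "closed ?Z"
        using continuous_closed_preimage_constant[OF continuous_on_subset[OF cont R(2)] closed_cball]
        by simp
      moreover have "p \<in> ?Z" using p R by simp
      ultimately obtain p' where p': "p' \<in> ?Z" "\<And>z. z \<in> ?Z \<Longrightarrow> dist y p' \<le> dist y z"
        using distance_attains_inf[of ?Z y] by blast
      define r where "r = dist y p'"
      have rR: "r < R" using p'(2)[OF \<open>p \<in> ?Z\<close>] y by (simp add: r_def dist_commute)
      have sub: "cball y r \<subseteq> cball p (2 * R)"
      proof
        fix z assume "z \<in> cball y r"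
        then show "z \<in> cball p (2 * R)"
          using rR y dist_triangle[of p z y] by simp
      qed
      have r: "r > 0" using neq p'(1) by (auto simp: r_def)
      show False
      proof (rule no_max_on_ball_boundary_with_zero_gradient[OF r, of y v g p'])
        show "continuous_on (cball y r) v" using cont sub R(2) continuous_on_subset by (metis subset_trans)
        show "GDERIV v p' :> 0" using grad0 p'(1) R(2) by auto
        have S: "z \<in> S" if "z \<in> cball y r" for z using that sub R(2) by blast
        have bS: "z \<in> S" if "z \<in> ball y r" for z using S that by auto
        show "GDERIV v z :> g z" "g differentiable (at z)" "divergence g z = 0" if "z \<in> ball y r" for z
          using bS[OF that] grad g by auto
        show "v z \<le> v p'" if "z \<in> cball y r" for z using S[OF that] le p' by auto
        show "v z < v p'" if "z \<in> ball y r" for z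
        proof -
          have "z \<in> cball p (2 * R)" using that sub ball_subset_cball by blast
          moreover have "\<not> dist y p' \<le> dist y z" using that by (simp add: r_def)
          ultimately have "v z \<noteq> M" using p'(2)[of z] by blast
          then show ?thesis using le[OF bS[OF that]] p'(1) by auto
        qed
      qed (simp add: r_def)
    qed
    then have "ball p R \<subseteq> {z \<in> S. v z = M}" using R by (auto simp: subset_iff)
    then show ?thesis using R(1) by blast
  qed
  then have "open {z \<in> S. v z = M}"
    unfolding open_contains_ball by blast
  moreover have "open {z \<in> S. v z \<noteq> M}"
    using continuous_open_preimage[OF cont \<open>open S\<close> open_Compl[OF closed_singleton[of M]]]
    by (simp add: vimage_def Int_def)
  ultimately show ?thesis
    using connectedD[OF \<open>connected S\<close>, of "{z \<in> S. v z = M}" "{z \<in> S. v z \<noteq> M}"] x0 \<open>x \<in> S\<close>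
    by blast
qed

section \<open>Outward normals and the mixed maximum principle\<close>

text \<open>Along \<open>d\<close> the defining function decreases strictly through zero, and inside
  \<open>V\<close> its sign decides membership in \<open>\<Omega>\<close>.\<close>

lemma GDERIV_defining_function_sign:
  assumes "open V" "q \<in> V" "GDERIV \<rho> q :> g" "\<rho> q = 0" and \<Omega>: "\<Omega> \<inter> V = {y \<in> V. \<rho> y < 0}"
    and "d \<bullet> g < 0"
  shows "\<forall>\<^sub>F s in at_right 0. q + s *\<^sub>R d \<in> \<Omega> \<and> q - s *\<^sub>R d \<notin> \<Omega>"
proof -
  have der: "((\<lambda>s. \<rho> (q + s *\<^sub>R d)) has_real_derivative d \<bullet> g) (at 0)"
    by (rule GDERIV_line) (use assms(3) in simp)
  obtain d1 where d1: "d1 > 0" "\<And>h. 0 < h \<Longrightarrow> h < d1 \<Longrightarrow> \<rho> (q + h *\<^sub>R d) < 0"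
    using DERIV_neg_dec_right[OF der assms(6)] assms(4) by auto
  obtain d2 where d2: "d2 > 0" "\<And>h. 0 < h \<Longrightarrow> h < d2 \<Longrightarrow> \<rho> (q - h *\<^sub>R d) > 0"
    using DERIV_neg_dec_left[OF der assms(6)] assms(4) by auto
  have near: "\<forall>\<^sub>F s in at_right 0. q + s *\<^sub>R c \<in> V" for c
  proof -
    have "((\<lambda>s. q + s *\<^sub>R c) \<longlongrightarrow> q + 0 *\<^sub>R c) (at_right 0)"
      by (intro tendsto_intros)
    then show ?thesis using topological_tendstoD[OF _ assms(1)] assms(2) by simp
  qed
  have "\<forall>\<^sub>F s in at_right 0. 0 < s \<and> s < d1 \<and> s < d2"
    using d1(1) d2(1) by (intro eventually_conj eventually_at_right_less)
      (auto simp: eventually_at_right_field)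
  then show ?thesis
    using near[of d] near[of "-d"]
  proof eventually_elim
    case (elim s)
    then have "\<rho> (q + s *\<^sub>R d) < 0" "\<rho> (q - s *\<^sub>R d) > 0" using d1(2) d2(2) by auto
    then show ?case using elim \<Omega> by (auto dest: less_asym)
  qed
qed

text \<open>A negative value would put \<open>q\<close> into the open set \<open>\<Omega>\<close>; a
  positive value would persist nearby and separate \<open>q\<close> from
  \<open>\<Omega>\<close>.\<close>

lemma defining_function_zero:
  assumes "open \<Omega>" "open V" "q \<in> V" "q \<in> frontier \<Omega>" "GDERIV \<rho> q :> g"
    and \<Omega>: "\<Omega> \<inter> V = {y \<in> V. \<rho> y < 0}"
  shows "\<rho> q = 0"
proof -
  have "q \<notin> \<Omega>" using assms(1,4) by (simp add: frontier_def interior_open)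
  then have "\<rho> q \<ge> 0" using \<Omega> assms(3) by force
  moreover have "\<not> \<rho> q > 0"
  proof
    assume pos: "\<rho> q > 0"
    have "isCont \<rho> q" using assms(5) has_derivative_continuous unfolding gderiv_def by blast
    then have "\<forall>\<^sub>F y in nhds q. \<rho> y > 0"
      using pos by (simp add: order_tendstoD(1) continuous_at tendsto_nhds_iff)
    moreover have "\<forall>\<^sub>F y in nhds q. y \<in> V" using assms(2,3) by (simp add: eventually_nhds_in_open)
    ultimately have "\<forall>\<^sub>F y in nhds q. y \<notin> \<Omega>"
      by eventually_elim (use \<Omega> in force)
    then obtain S where "open S" "q \<in> S" "S \<inter> \<Omega> = {}" by (auto simp: eventually_nhds)
    then show False using assms(4) by (auto simp: frontier_def closure_iff_nhds_not_empty)
  qed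
  ultimately show ?thesis by simp
qed

text \<open>The third part makes the normal independent of the defining function. If two defining
  functions gave distinct unit normals \<open>\<nu>\<close> and \<open>\<mu>\<close>, a short step
  from \<open>q\<close> in direction \<open>\<mu> - \<nu>\<close> would enter
  \<open>\<Omega>\<close> according to the first and avoid it according to the second.\<close>

lemma outward_unit_normal_props:
  assumes "open \<Omega>" "outward_unit_normal \<Omega> q \<nu>"
  shows norm_outward_unit_normal: "norm \<nu> = 1"
    and outward_unit_normal_inside: "\<forall>\<^sub>F t in at_left 0. q + t *\<^sub>R \<nu> \<in> \<Omega>"
    and outward_unit_normal_unique:
      "\<And>V \<rho> g. open V \<Longrightarrow> q \<in> V \<Longrightarrow> GDERIV \<rho> q :> g \<Longrightarrow> g \<noteq> 0 \<Longrightarrow>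
         \<Omega> \<inter> V = {y \<in> V. \<rho> y < 0} \<Longrightarrow> \<nu> = (1 / norm g) *\<^sub>R g"
proof -
  obtain V \<rho> g where V: "open V" "q \<in> V" "\<And>y. y \<in> V \<Longrightarrow> GDERIV \<rho> y :> g y \<and> g y \<noteq> 0"
    "\<Omega> \<inter> V = {y \<in> V. \<rho> y < 0}" "q \<in> frontier \<Omega>" "\<nu> = (1 / norm (g q)) *\<^sub>R g q"
    using assms(2) unfolding outward_unit_normal_def by blast
  have g: "GDERIV \<rho> q :> g q" "g q \<noteq> 0" using V(2,3) by auto
  have z: "\<rho> q = 0" by (rule defining_function_zero[OF assms(1) V(1,2,5) g(1) V(4)])
  show norm: "norm \<nu> = 1" using g(2) by (simp add: V(6))
  have "(- \<nu>) \<bullet> g q < 0" using g(2) by (simp add: V(6))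
  from GDERIV_defining_function_sign[OF V(1,2) g(1) z V(4) this]
  have "\<forall>\<^sub>F s in at_right 0. q + (- s) *\<^sub>R \<nu> \<in> \<Omega>"
    by eventually_elim simp
  then show "\<forall>\<^sub>F t in at_left 0. q + t *\<^sub>R \<nu> \<in> \<Omega>"
    by (simp add: eventually_at_left_to_right[of _ 0])
  show "\<nu> = (1 / norm g') *\<^sub>R g'"
    if V': "open V'" "q \<in> V'" "GDERIV \<rho>' q :> g'" "g' \<noteq> 0" "\<Omega> \<inter> V' = {y \<in> V'. \<rho>' y < 0}"
    for V' \<rho>' g'
  proof (rule ccontr)
    define \<mu> where "\<mu> = (1 / norm g') *\<^sub>R g'"
    assume "\<nu> \<noteq> (1 / norm g') *\<^sub>R g'"
    then have neq: "\<nu> \<noteq> \<mu>" by (simp add: \<mu>_def)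
    have \<mu>: "norm \<mu> = 1" using V'(4) by (simp add: \<mu>_def)
    have z': "\<rho>' q = 0" by (rule defining_function_zero[OF assms(1) V'(1,2) V(5) V'(3,5)])
    \<comment> \<open>Strict Cauchy-Schwarz for distinct unit vectors.\<close>
    have "0 < (\<mu> - \<nu>) \<bullet> (\<mu> - \<nu>)" using neq by simp
    then have lt: "\<mu> \<bullet> \<nu> < 1"
      using norm \<mu> by (simp add: inner_simps norm_eq_1 inner_commute)
    have gq: "g q = norm (g q) *\<^sub>R \<nu>" "g' = norm g' *\<^sub>R \<mu>"
      using g(2) V'(4) by (simp_all add: V(6) \<mu>_def)
    have "(\<mu> - \<nu>) \<bullet> \<nu> < 0" "(\<nu> - \<mu>) \<bullet> \<mu> < 0"
      using lt norm \<mu> by (simp_all add: inner_simps norm_eq_1 inner_commute)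
    then have "(\<mu> - \<nu>) \<bullet> g q < 0" "(\<nu> - \<mu>) \<bullet> g' < 0"
      using g(2) V'(4) by (subst gq; simp add: mult_less_0_iff)+
    from GDERIV_defining_function_sign[OF V(1,2) g(1) z V(4) this(1)]
      GDERIV_defining_function_sign[OF V'(1,2,3) z' V'(5) this(2)]
    have "\<forall>\<^sub>F s in at_right (0::real). False"
      by eventually_elim (simp add: algebra_simps)
    then show False by simp
  qed
qed

text \<open>Near \<open>p\<close> the defining function vanishes on the frontier, so its first-order
  expansion at \<open>p\<close> bounds the component along \<open>e\<close>. By uniqueness of the
  normal, \<open>\<nu>\<close> is the normalised gradient, which is continuous.\<close>

lemma C1_boundary_flat:
  assumes "open \<Omega>" "outward_unit_normal \<Omega> p e" "0 < \<eta>" "0 < \<theta>"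
  shows "\<exists>\<delta>>0. \<forall>q\<in>frontier \<Omega>. dist p q < \<delta> \<longrightarrow>
           \<bar>(q - p) \<bullet> e\<bar> \<le> \<eta> * dist p q \<and> (\<forall>\<nu>. outward_unit_normal \<Omega> q \<nu> \<longrightarrow> dist \<nu> e < \<theta>)"
proof -
  obtain V \<rho> g where V: "open V" "p \<in> V" "\<And>y. y \<in> V \<Longrightarrow> GDERIV \<rho> y :> g y \<and> g y \<noteq> 0"
    "continuous_on V g"
    "\<Omega> \<inter> V = {y \<in> V. \<rho> y < 0}" "p \<in> frontier \<Omega>" "e = (1 / norm (g p)) *\<^sub>R g p"
    using assms(2) unfolding outward_unit_normal_def by blast
  have g: "GDERIV \<rho> p :> g p" "g p \<noteq> 0" using V(2,3) by auto
  have z: "\<rho> q = 0" if "q \<in> V" "q \<in> frontier \<Omega>" for q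
    using defining_function_zero[OF assms(1) V(1) that _ V(5)] V(3)[OF that(1)] by blast
  \<comment> \<open>The factor \<open>norm (g p)\<close> cancels later, since \<open>e\<close> is
    the gradient divided by its norm.\<close>
  have "0 < \<eta> * norm (g p)" using assms(3) g(2) by simp
  then obtain d1 where d1: "d1 > 0"
    "\<And>y. norm (y - p) < d1 \<Longrightarrow> norm (\<rho> y - \<rho> p - (y - p) \<bullet> g p) \<le> \<eta> * norm (g p) * norm (y - p)"
    using g(1) unfolding gderiv_def has_derivative_at_alt by blast
  obtain d2 where d2: "d2 > 0" "ball p d2 \<subseteq> V" using V(1,2) openE by blast
  have "continuous_on V (\<lambda>y. (1 / norm (g y)) *\<^sub>R g y)"
    using V(3) by (intro continuous_intros V(4)) auto
  then obtain d3 where d3: "d3 > 0"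
    "\<And>y. y \<in> V \<Longrightarrow> dist y p < d3 \<Longrightarrow> dist ((1 / norm (g y)) *\<^sub>R g y) e < \<theta>"
    unfolding continuous_on_iff V(7) using V(2) assms(4) by metis
  show ?thesis
  proof (intro exI[of _ "min d1 (min d2 d3)"] conjI ballI impI allI)
    fix q assume q: "q \<in> frontier \<Omega>" "dist p q < min d1 (min d2 d3)"
    then have qV: "q \<in> V" using d2(2) by auto
    have "norm (\<rho> q - \<rho> p - (q - p) \<bullet> g p) \<le> \<eta> * norm (g p) * norm (q - p)"
      using d1(2)[of q] q(2) by (simp add: dist_norm norm_minus_commute)
    then have "\<bar>(q - p) \<bullet> g p\<bar> \<le> \<eta> * dist p q * norm (g p)"
      using z[OF qV q(1)] z[OF V(2) V(6)] by (simp add: dist_norm norm_minus_commute mult_ac)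
    then show "\<bar>(q - p) \<bullet> e\<bar> \<le> \<eta> * dist p q"
      using g(2) by (simp add: V(7) abs_mult field_simps)
    fix \<nu> assume \<nu>: "outward_unit_normal \<Omega> q \<nu>"
    have "\<nu> = (1 / norm (g q)) *\<^sub>R g q"
      using outward_unit_normal_unique[OF assms(1) \<nu> V(1) qV _ _ V(5)] V(3)[OF qV] by blast
    then show "dist \<nu> e < \<theta>" using d3(2)[OF qV] q(2) by (simp add: dist_commute)
  qed (use d1 d2 d3 in auto)
qed

text \<open>Hopf's boundary point lemma fails at a single point of a \<open>C\<^sup>1\<close> boundary. But if the normal
  derivative vanishes on the whole boundary near \<open>p\<close>, the perturbation by a paraboloid
  yields a nearby point \<open>q\<close> at which this is contradicted.\<close>

lemma no_strict_max_at_neumann_boundary: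
  fixes v :: "real ^ 'n \<Rightarrow> real"
  assumes "open \<Omega>" and cont: "continuous_on (closure \<Omega>) v"
    and grad: "\<And>x. x \<in> \<Omega> \<Longrightarrow> GDERIV v x :> g x"
    and g: "\<And>x. x \<in> \<Omega> \<Longrightarrow> g differentiable (at x)" "\<And>x. x \<in> \<Omega> \<Longrightarrow> divergence g x = 0"
    and p: "outward_unit_normal \<Omega> p e"
    and near: "\<forall>\<^sub>F q in nhds p. q \<in> frontier \<Omega> \<longrightarrow>
      (\<exists>\<nu>. outward_unit_normal \<Omega> q \<nu> \<and> has_normal_derivative v q \<nu> 0)"
    and less: "\<And>x. x \<in> \<Omega> \<Longrightarrow> v x < v p" and le: "\<And>x. x \<in> closure \<Omega> \<Longrightarrow> v x \<le> v p"
  shows False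
proof -
  have e: "norm e = 1" by (rule norm_outward_unit_normal[OF assms(1) p])
  have pf: "p \<in> frontier \<Omega>" using p by (auto simp: outward_unit_normal_def)
  \<comment> \<open>The constants are tuned so that \<open>k * CARD('n) < A\<close>,
    \<open>A * (\<eta> * \<delta>) = 1 / 32\<close> and \<open>k * \<delta> = 1 / 4\<close>: strict
    subharmonicity, yet negligible influence of the \<open>A\<close> term on the nearly flat
    frontier.\<close>
  define N where "N = real CARD('n) + 1"
  have N: "N \<ge> 1" by (simp add: N_def)
  define \<eta> where "\<eta> = 1 / (8 * N)"
  have \<eta>: "0 < \<eta>" "N * \<eta> = 1 / 8" "\<eta> \<le> 1 / 8" using N by (auto simp: \<eta>_def field_simps)
  obtain \<delta>1 where \<delta>1: "\<delta>1 > 0" "\<And>q. q \<in> frontier \<Omega> \<Longrightarrow> dist p q < \<delta>1 \<Longrightarrow>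
      \<bar>(q - p) \<bullet> e\<bar> \<le> \<eta> * dist p q \<and> (\<forall>\<nu>. outward_unit_normal \<Omega> q \<nu> \<longrightarrow> dist \<nu> e < 1 / 2)"
    using C1_boundary_flat[OF assms(1) p \<eta>(1), of "1/2"] by auto
  obtain \<delta>2 where \<delta>2: "\<delta>2 > 0" "\<And>q. q \<in> frontier \<Omega> \<Longrightarrow> dist p q < \<delta>2 \<Longrightarrow>
      \<exists>\<nu>. outward_unit_normal \<Omega> q \<nu> \<and> has_normal_derivative v q \<nu> 0"
    using near unfolding eventually_nhds_metric by (metis dist_commute)
  define \<delta> where "\<delta> = min \<delta>1 \<delta>2 / 2"
  have \<delta>: "0 < \<delta>" "\<delta> < \<delta>1" "\<delta> < \<delta>2" using \<delta>1(1) \<delta>2(1) by (auto simp: \<delta>_def min_def)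
  define A where "A = N / (4 * \<delta>)"
  define k where "k = 1 / (4 * \<delta>)"
  have kA: "k * CARD('n) < A" using \<delta>(1) by (simp add: k_def A_def N_def divide_strict_right_mono)
  have A0: "A > 0" "A * (\<eta> * \<delta>) = 1 / 32" and k: "k > 0" "k * \<delta> = 1 / 4"
    using \<delta>(1) N by (auto simp: A_def k_def \<eta>_def)
  let ?b = "barrier p e A k"
  have flat: "\<bar>(q - p) \<bullet> e\<bar> \<le> \<eta> * \<delta>" if "q \<in> frontier \<Omega>" "dist p q \<le> \<delta>" for q
  proof -
    have "\<bar>(q - p) \<bullet> e\<bar> \<le> \<eta> * dist p q" using \<delta>1(2)[of q] that \<delta> by auto
    also have "\<dots> \<le> \<eta> * \<delta>" using that \<eta>(1) by simp
    finally show ?thesis .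
  qed
  \<comment> \<open>The \<open>k\<close> term contributes \<open>- \<delta> / 4\<close>; flatness
    bounds the linear term by \<open>\<delta> / 8\<close> and the \<open>A\<close> term by
    \<open>\<delta> / 256\<close>.\<close>
  have neg: "?b q < 0" if q: "q \<in> frontier \<Omega>" "dist p q = \<delta>" for q
  proof -
    define t where "t = (q - p) \<bullet> e"
    have t: "\<bar>t\<bar> \<le> \<eta> * \<delta>" using flat[of q] q by (simp add: t_def)
    have "A * t\<^sup>2 = (A * \<bar>t\<bar>) * \<bar>t\<bar>" by (simp add: power2_eq_square)
    also have "\<dots> \<le> (A * (\<eta> * \<delta>)) * (\<eta> * \<delta>)"
      using t A0(1) by (intro mult_mono) auto
    also have "\<dots> = \<eta> * \<delta> / 32" by (simp add: A0(2))
    finally have "A * t\<^sup>2 \<le> \<eta> * \<delta> / 32" .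
    moreover have "\<eta> * \<delta> \<le> \<delta> / 8" using \<eta>(3) \<delta>(1) mult_right_mono[of \<eta> "1/8" \<delta>] by simp
    moreover have "(q - p) \<bullet> (q - p) = \<delta> * \<delta>"
      using q(2) by (metis dist_commute dist_norm dot_square_norm power2_eq_square)
    then have "k * ((q - p) \<bullet> (q - p)) = \<delta> / 4" using k(2) by (simp flip: mult.assoc)
    moreover have "?b q = A * t\<^sup>2 - k * ((q - p) \<bullet> (q - p)) - t" by (simp add: barrier_def t_def)
    ultimately show ?thesis using t \<delta>(1) by linarith
  qed
  let ?K = "closure \<Omega> \<inter> cball p \<delta>"
  obtain \<epsilon> q where \<epsilon>: "0 < \<epsilon>" and q: "q \<in> ?K" "q \<notin> \<Omega> \<inter> ball p \<delta>" "q \<notin> sphere p \<delta>"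
    and max: "\<And>x. x \<in> ?K \<Longrightarrow> v x + \<epsilon> * ?b x \<le> v q + \<epsilon> * ?b q"
    and "v p \<le> v q + \<epsilon> * ?b q"
  proof (rule max_with_barrier[where D="\<Omega> \<inter> ball p \<delta>" and K="?K"
        and T="sphere p \<delta>" and p=p and v=v and g=g and M="v p" and e=e and A=A and k=k])
    show "compact ?K" by (simp add: closed_Int_compact)
    show "continuous_on ?K v" using cont continuous_on_subset by blast
    show "open (\<Omega> \<inter> ball p \<delta>)" using assms(1) by auto
    show "\<Omega> \<inter> ball p \<delta> \<subseteq> ?K" using closure_subset by fastforce
    \<comment> \<open>On the outer sphere, points with nonnegative barrier are not on the frontier,
      hence inside \<open>\<Omega>\<close>, where the inequality is strict.\<close>
    show "v x < v p" if "x \<in> ?K \<inter> sphere p \<delta>" "0 \<le> ?b x" for x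
    proof -
      have "x \<notin> frontier \<Omega>" using neg[of x] that by auto
      then have "x \<in> \<Omega>" using that assms(1) by (auto simp: frontier_def interior_open)
      then show ?thesis by (rule less)
    qed
    show "p \<in> ?K" using pf \<delta>(1) by (auto simp: frontier_def)
  qed (use grad g le e kA in auto)
  have qd: "dist p q < \<delta>" using q by auto
  have qf: "q \<in> frontier \<Omega>" using q qd assms(1) by (auto simp: frontier_def interior_open)
  obtain \<nu> where \<nu>: "outward_unit_normal \<Omega> q \<nu>" "has_normal_derivative v q \<nu> 0"
    using \<delta>2(2)[OF qf] qd \<delta> by auto
  have n1: "norm \<nu> = 1" by (rule norm_outward_unit_normal[OF assms(1) \<nu>(1)])
  \<comment> \<open>The normal at \<open>q\<close> is still close to \<open>e\<close>, so the
    barrier keeps a negative slope: the part along \<open>e\<close> is at most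
    \<open>- 105 / 128\<close>, and the \<open>k\<close> term adds at most
    \<open>1 / 2\<close>.\<close>
  have slope: "\<nu> \<bullet> barrier_grad p e A k q < 0"
  proof -
    define t where "t = (q - p) \<bullet> e"
    have "\<bar>t\<bar> \<le> \<eta> * \<delta>" using flat[OF qf] qd by (simp add: t_def)
    then have "A * \<bar>t\<bar> \<le> 1 / 32" using A0 mult_left_mono[of "\<bar>t\<bar>" "\<eta> * \<delta>" A] by linarith
    moreover have "A * t \<le> A * \<bar>t\<bar>" using A0(1) by simp
    ultimately have t: "2 * A * t \<le> 1 / 16" by simp
    have "norm (\<nu> - e) \<le> 1 / 2"
      using \<delta>1(2)[OF qf] qd \<delta> \<nu>(1) by (force simp: dist_norm)
    then have "(norm (\<nu> - e))\<^sup>2 \<le> (1 / 2)\<^sup>2" by (intro power_mono) auto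
    then have "(\<nu> - e) \<bullet> (\<nu> - e) \<le> 1 / 4"
      by (simp add: dot_square_norm power2_eq_square)
    then have ne: "\<nu> \<bullet> e \<ge> 7 / 8"
      using n1 e by (simp add: inner_simps norm_eq_1 inner_commute)
    have "(2 * A * t - 1) * (\<nu> \<bullet> e) \<le> (- (15 / 16)) * (\<nu> \<bullet> e)"
      using t ne by (intro mult_right_mono) auto
    also have "\<dots> \<le> (- (15 / 16)) * (7 / 8)" using ne by simp
    finally have "(2 * A * t - 1) * (\<nu> \<bullet> e) \<le> - (105 / 128)" by simp
    moreover have "\<bar>\<nu> \<bullet> (q - p)\<bar> \<le> \<delta>"
      using Cauchy_Schwarz_ineq2[of \<nu> "q - p"] n1 qd by (simp add: dist_norm norm_minus_commute)
    then have "k * \<bar>\<nu> \<bullet> (q - p)\<bar> \<le> 1 / 4"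
      using k mult_left_mono[of "\<bar>\<nu> \<bullet> (q - p)\<bar>" \<delta> k] by linarith
    moreover have "k * - (\<nu> \<bullet> (q - p)) \<le> k * \<bar>\<nu> \<bullet> (q - p)\<bar>" using k(1) by (intro mult_left_mono) auto
    moreover have "\<nu> \<bullet> barrier_grad p e A k q = (2 * A * t - 1) * (\<nu> \<bullet> e) - 2 * (k * (\<nu> \<bullet> (q - p)))"
      by (simp add: barrier_grad_def t_def inner_diff_right[of \<nu> "_ *\<^sub>R _"])
    ultimately show ?thesis by linarith
  qed
  \<comment> \<open>At \<open>q\<close> the function \<open>v\<close> has zero normal derivative, so
    the perturbed function has slope \<open>\<epsilon>\<close> times that of the barrier. It is
    therefore larger just inside \<open>\<Omega>\<close>, against maximality at
    \<open>q\<close>.\<close>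
  let ?f = "\<lambda>s. v (q + s *\<^sub>R \<nu>) + \<epsilon> * ?b (q + s *\<^sub>R \<nu>)"
  have "((\<lambda>s. ?b (q + s *\<^sub>R \<nu>)) has_real_derivative \<nu> \<bullet> barrier_grad p e A k q) (at_left 0)"
    by (rule GDERIV_line) (simp add: GDERIV_barrier)
  then have "(?f has_real_derivative 0 + \<epsilon> * (\<nu> \<bullet> barrier_grad p e A k q)) (at_left 0)"
    using \<nu>(2) unfolding has_normal_derivative_def by (intro DERIV_add DERIV_cmult)
  moreover have "0 + \<epsilon> * (\<nu> \<bullet> barrier_grad p e A k q) < 0"
    using slope \<epsilon> by (simp add: mult_pos_neg)
  ultimately obtain d where "0 < d" and d: "\<And>h. 0 < h \<Longrightarrow> 0 - h \<in> {..<0} \<Longrightarrow> h < d \<Longrightarrow> ?f 0 < ?f (0 - h)"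
    using has_real_derivative_neg_dec_left[of ?f _ 0 "{..<0}"] by blast
  have "\<forall>\<^sub>F t in at_left (0::real). - d < t \<and> - (\<delta> - dist p q) < t \<and> t < 0"
    using \<open>0 < d\<close> qd unfolding eventually_at_left_field
    by (intro exI[of _ "max (- d) (- (\<delta> - dist p q))"]) auto
  with outward_unit_normal_inside[OF assms(1) \<nu>(1)]
  have "\<forall>\<^sub>F t in at_left (0::real). False"
  proof eventually_elim
    case (elim t)
    have "dist p (q + t *\<^sub>R \<nu>) \<le> dist p q + dist q (q + t *\<^sub>R \<nu>)" by (rule dist_triangle)
    also have "dist q (q + t *\<^sub>R \<nu>) = - t" using elim n1 by (simp add: dist_norm)
    finally have "q + t *\<^sub>R \<nu> \<in> ?K" using elim closure_subset by (auto simp: subset_iff)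
    from max[OF this] d[of "- t"] elim show ?case by simp
  qed
  then show False by simp
qed

text \<open>A maximum above \<open>m\<close> at an interior point would make \<open>v\<close>
  constant on a component whose closure meets the Dirichlet part. So it is attained only on
  \<open>\<Gamma>3\<close>, which the boundary lemma excludes.\<close>

lemma mixed_max_principle:
  fixes v :: "real ^ 'n \<Rightarrow> real"
  assumes dom: "mixed_domain \<Omega> \<Gamma>1 \<Gamma>2 \<Gamma>3 n" and cont: "continuous_on (closure \<Omega>) v"
    and grad: "\<And>x. x \<in> \<Omega> \<Longrightarrow> GDERIV v x :> g x"
    and g: "\<And>x. x \<in> \<Omega> \<Longrightarrow> g differentiable (at x)" "\<And>x. x \<in> \<Omega> \<Longrightarrow> divergence g x = 0"
    and neumann: "\<And>x. x \<in> \<Gamma>3 \<Longrightarrow> has_normal_derivative v x (n x) 0"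
    and dirichlet: "\<And>x. x \<in> \<Gamma>1 \<union> \<Gamma>2 \<Longrightarrow> v x \<le> m" and "x \<in> closure \<Omega>"
  shows "v x \<le> m"
proof (rule ccontr)
  assume "\<not> v x \<le> m"
  have op: "open \<Omega>" and "bounded \<Omega>" and fr: "frontier \<Omega> = \<Gamma>1 \<union> \<Gamma>2 \<union> \<Gamma>3"
    and normal: "\<And>x. x \<in> \<Gamma>3 \<Longrightarrow> outward_unit_normal \<Omega> x (n x)"
    and comp: "\<And>C. C \<in> components \<Omega> \<Longrightarrow> closure C \<inter> (\<Gamma>1 \<union> \<Gamma>2) \<noteq> {}"
    using dom by (auto simp: mixed_domain_def)
  have "compact (closure \<Omega>)" using \<open>bounded \<Omega>\<close> by (simp add: compact_eq_bounded_closed bounded_closure)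
  then obtain p where p: "p \<in> closure \<Omega>" and max: "\<And>y. y \<in> closure \<Omega> \<Longrightarrow> v y \<le> v p"
    using continuous_attains_sup[OF _ _ cont] \<open>x \<in> closure \<Omega>\<close> by (metis empty_iff)
  have pm: "v p > m" using max[OF \<open>x \<in> closure \<Omega>\<close>] \<open>\<not> v x \<le> m\<close> by simp
  have less: "v y < v p" if y: "y \<in> \<Omega>" for y
  proof (rule ccontr)
    assume "\<not> v y < v p"
    then have vy: "v y = v p" using max[of y] closure_subset y by fastforce
    define C where "C = connected_component_set \<Omega> y"
    have C: "C \<in> components \<Omega>" using y by (auto simp: components_def C_def)
    have sub: "C \<subseteq> \<Omega>" by (rule in_components_subset[OF C])
    have "y \<in> C" using y by (simp add: C_def connected_component_refl)
    have const: "v z = v p" if "z \<in> C" for z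
    proof (rule harmonic_interior_max_constant[of C v g "v p" y z])
      show "open C" by (rule open_components[OF op C])
      show "connected C" by (rule in_components_connected[OF C])
      show "v x \<le> v p" if "x \<in> C" for x using that sub max closure_subset by (meson subsetD)
    qed (use grad g sub vy \<open>y \<in> C\<close> that in auto)
    have subcl: "closure C \<subseteq> closure \<Omega>" by (rule closure_mono[OF sub])
    have "v z = v p" if "z \<in> closure C" for z
      by (rule continuous_constant_on_closure[OF continuous_on_subset[OF cont subcl] const that])
    then show False using comp[OF C] dirichlet pm by fastforce
  qed
  then have "p \<in> frontier \<Omega>" using p op by (auto simp: frontier_def interior_open)
  then have p3: "p \<in> \<Gamma>3" using fr dirichlet[of p] pm by auto
  show False
  proof (rule no_strict_max_at_neumann_boundary[OF op cont grad g normal[OF p3] _ less max])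
    \<comment> \<open>By continuity \<open>v > m\<close> persists near \<open>p\<close>, so all
      frontier points near \<open>p\<close> lie on \<open>\<Gamma>3\<close>. This supplies the
      Neumann condition on a whole neighbourhood.\<close>
    have "(v \<longlongrightarrow> v p) (at p within closure \<Omega>)"
      using cont p by (simp add: continuous_on)
    then have "\<forall>\<^sub>F q in at p within closure \<Omega>. v q > m" using pm order_tendstoD(1) by blast
    then have "\<forall>\<^sub>F q in nhds p. q \<noteq> p \<longrightarrow> q \<in> closure \<Omega> \<longrightarrow> v q > m"
      by (simp add: eventually_at_filter)
    then show "\<forall>\<^sub>F q in nhds p. q \<in> frontier \<Omega> \<longrightarrow>
      (\<exists>\<nu>. outward_unit_normal \<Omega> q \<nu> \<and> has_normal_derivative v q \<nu> 0)"
    proof eventually_elim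
      case (elim q)
      show ?case
      proof
        assume q: "q \<in> frontier \<Omega>"
        then have "v q > m" using elim pm by (cases "q = p") (auto simp: frontier_def)
        then have "q \<in> \<Gamma>3" using q fr dirichlet[of q] by auto
        then show "\<exists>\<nu>. outward_unit_normal \<Omega> q \<nu> \<and> has_normal_derivative v q \<nu> 0"
          using normal neumann by blast
      qed
    qed
  qed
qed

section \<open>Solutions of the mixed problem\<close>

text \<open>Chain rule for an outer function that may be differentiable only one-sidedly, as at an
  end point of an interval; it suffices that \<open>v\<close> maps the open set
  \<open>\<Omega>\<close> into \<open>I\<close>.\<close>

lemma GDERIV_compose_within:
  assumes "open \<Omega>" "x \<in> \<Omega>" "GDERIV v x :> g" "v ` \<Omega> \<subseteq> I"
    and "(H has_real_derivative h) (at (v x) within I)"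
  shows "GDERIV (\<lambda>y. H (v y)) x :> h *\<^sub>R g"
proof -
  have "(v has_derivative (\<lambda>h. h \<bullet> g)) (at x within \<Omega>)"
    using assms(3) has_derivative_at_withinI unfolding gderiv_def by blast
  moreover have "(H has_derivative (*) h) (at (v x) within v ` \<Omega>)"
    using DERIV_subset[OF assms(5,4)] by (simp add: has_field_derivative_def)
  ultimately have "((\<lambda>y. H (v y)) has_derivative (\<lambda>y. h * (y \<bullet> g))) (at x within \<Omega>)"
    by (rule has_derivative_in_compose)
  then show ?thesis
    using at_within_open[OF assms(2,1)] by (simp add: gderiv_def)
qed

lemma has_normal_derivative_0_compose:
  assumes "has_normal_derivative v x \<nu> 0" "(H has_real_derivative h) (at (v x) within I)"
    and "\<forall>\<^sub>F t in at_left 0. v (x + t *\<^sub>R \<nu>) \<in> I"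
  shows "has_normal_derivative (\<lambda>y. H (v y)) x \<nu> 0"
proof -
  obtain b where b: "b < 0" "\<And>t. b < t \<Longrightarrow> t < 0 \<Longrightarrow> v (x + t *\<^sub>R \<nu>) \<in> I"
    using assms(3) unfolding eventually_at_left_field by blast
  \<comment> \<open>Shrinking to \<open>{b<..<0}\<close> keeps the image in \<open>I\<close> without
    changing the limit.\<close>
  have at: "at 0 within {b<..<0} = at_left (0::real)"
    by (rule at_within_nhd[where S="{b<..}"]) (use b(1) in auto)
  have "((\<lambda>t. v (x + t *\<^sub>R \<nu>)) has_real_derivative 0) (at 0 within {b<..<0})"
    using assms(1) by (simp add: has_normal_derivative_def at)
  moreover have "(H has_real_derivative h) (at (v (x + 0 *\<^sub>R \<nu>)) within (\<lambda>t. v (x + t *\<^sub>R \<nu>)) ` {b<..<0})"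
    using DERIV_subset[OF assms(2)] b(2) by (simp add: image_subset_iff)
  ultimately have "(H \<circ> (\<lambda>t. v (x + t *\<^sub>R \<nu>)) has_real_derivative h * 0) (at 0 within {b<..<0})"
    by (intro DERIV_image_chain)
  then show ?thesis by (simp add: has_normal_derivative_def at comp_def)
qed

lemma has_normal_derivative_0_compose_on:
  assumes dom: "mixed_domain \<Omega> \<Gamma>1 \<Gamma>2 \<Gamma>3 n" and x: "x \<in> \<Gamma>3"
    and "has_normal_derivative v x (n x) 0" "(H has_real_derivative h) (at (v x) within I)"
    and "v ` \<Omega> \<subseteq> I"
  shows "has_normal_derivative (\<lambda>y. H (v y)) x (n x) 0"
proof (rule has_normal_derivative_0_compose[OF assms(3,4)])
  have "open \<Omega>" "outward_unit_normal \<Omega> x (n x)" using dom x by (auto simp: mixed_domain_def)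
  from outward_unit_normal_inside[OF this]
  show "\<forall>\<^sub>F t in at_left 0. v (x + t *\<^sub>R n x) \<in> I"
    by eventually_elim (use assms(5) in auto)
qed

section \<open>Flux fields of class C1 and locality of the divergence\<close>

lemma C1_on_scaleR:
  assumes "C1_on S F"
  shows "C1_on S (\<lambda>x. c *\<^sub>R F x)"
proof -
  obtain F' where F': "\<And>x. x \<in> S \<Longrightarrow> (F has_derivative blinfun_apply (F' x)) (at x within S)"
    "continuous_on S F'"
    using assms unfolding C1_on_def by blast
  have "((\<lambda>x. c *\<^sub>R F x) has_derivative blinfun_apply (c *\<^sub>R F' x)) (at x within S)" if "x \<in> S" for x
    using has_derivative_scaleR_right[OF F'(1)[OF that]] by (simp add: scaleR_blinfun.rep_eq)
  moreover have "continuous_on S (\<lambda>x. c *\<^sub>R F' x)"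
    by (intro continuous_intros F')
  ultimately show ?thesis unfolding C1_on_def by (intro exI[of _ "\<lambda>x. c *\<^sub>R F' x"]) blast
qed

lemma C1_on_imp_differentiable:
  assumes "C1_on S F" "open S" "x \<in> S"
  shows "F differentiable (at x)"
  using assms at_within_open[OF assms(3,2)] unfolding C1_on_def differentiable_def by metis

lemma C1_on_cong:
  assumes "C1_on S F" "\<And>x. x \<in> S \<Longrightarrow> F x = G x"
  shows "C1_on S G"
proof -
  obtain F' where F': "\<And>x. x \<in> S \<Longrightarrow> (F has_derivative blinfun_apply (F' x)) (at x within S)"
    "continuous_on S F'"
    using assms(1) unfolding C1_on_def by blast
  have "(G has_derivative blinfun_apply (F' x)) (at x within S)" if "x \<in> S" for x
    using has_derivative_transform[OF that _ F'(1)[OF that], of G] assms(2) by auto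
  then show ?thesis using F'(2) unfolding C1_on_def by blast
qed

lemma divergence_cong:
  assumes "F differentiable (at x)" "open S" "x \<in> S" "\<And>y. y \<in> S \<Longrightarrow> F y = G y"
  shows "G differentiable (at x)" "divergence G x = divergence F x"
proof -
  obtain F' where F': "(F has_derivative F') (at x)" using assms(1) by (auto simp: differentiable_def)
  then have G: "(G has_derivative F') (at x)"
    using has_derivative_transform_within_open[OF F' assms(2,3)] assms(4) by blast
  then show "G differentiable (at x)" by (auto simp: differentiable_def)
  show "divergence G x = divergence F x" by (simp add: divergence_eq[OF F'] divergence_eq[OF G])
qed

lemma div_grad_eq_0I:
  assumes "open \<Omega>" "C1_on \<Omega> F" "\<And>x. x \<in> \<Omega> \<Longrightarrow> divergence F x = 0"
    and "\<And>x. x \<in> \<Omega> \<Longrightarrow> GDERIV v x :> g x" "continuous_on \<Omega> g"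
    and "\<And>x. x \<in> \<Omega> \<Longrightarrow> k x *\<^sub>R g x = F x"
  shows "div_grad_eq_0 \<Omega> k v"
  unfolding div_grad_eq_0_def
proof (intro exI[of _ g] conjI ballI)
  show "C1_on \<Omega> (\<lambda>x. k x *\<^sub>R g x)"
    by (rule C1_on_cong[OF assms(2)]) (simp add: assms(6))
  show "divergence (\<lambda>x. k x *\<^sub>R g x) x = 0" if "x \<in> \<Omega>" for x
    using divergence_cong(2)[OF C1_on_imp_differentiable[OF assms(2,1) that] assms(1) that, of "\<lambda>x. k x *\<^sub>R g x"]
      assms(3,6) that by simp
qed (use assms in auto)

text \<open>The gradient of \<open>H(v)\<close> is \<open>h(v)\<close> times that of
  \<open>v\<close>, so \<open>flux\<close> says that the new flux is the old one times the constant
  \<open>m\<close>, hence again C1 and divergence free. With suitable \<open>H\<close> this removes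
  a coefficient, introduces one, or rescales affinely.\<close>

lemma mixed_solution_compose:
  assumes dom: "mixed_domain \<Omega> \<Gamma>1 \<Gamma>2 \<Gamma>3 n" and sol: "mixed_solution \<Omega> \<Gamma>1 \<Gamma>2 \<Gamma>3 n k c1 c2 v"
    and I: "\<And>x. x \<in> closure \<Omega> \<Longrightarrow> v x \<in> I"
    and H: "\<And>s. s \<in> I \<Longrightarrow> (H has_real_derivative h s) (at s within I)"
    and h: "continuous_on I h"
    and flux: "\<And>x. x \<in> \<Omega> \<Longrightarrow> k' x * h (v x) = m * k x"
  shows "mixed_solution \<Omega> \<Gamma>1 \<Gamma>2 \<Gamma>3 n k' (H c1) (H c2) (\<lambda>x. H (v x))"
proof -
  have op: "open \<Omega>" and "\<Gamma>3 \<subseteq> closure \<Omega>"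
    using dom by (auto simp: mixed_domain_def frontier_def)
  have cont: "continuous_on (closure \<Omega>) v" and div: "div_grad_eq_0 \<Omega> k v"
    using sol by (auto simp: mixed_solution_def)
  obtain g where g: "\<And>x. x \<in> \<Omega> \<Longrightarrow> GDERIV v x :> g x" "continuous_on \<Omega> g"
    "C1_on \<Omega> (\<lambda>x. k x *\<^sub>R g x)" "\<And>x. x \<in> \<Omega> \<Longrightarrow> divergence (\<lambda>x. k x *\<^sub>R g x) x = 0"
    using div unfolding div_grad_eq_0_def by blast
  have sub: "\<Omega> \<subseteq> closure \<Omega>" by (rule closure_subset)
  have I': "v ` \<Omega> \<subseteq> I" using I sub by blast
  have vc: "continuous_on \<Omega> v" using cont sub by (rule continuous_on_subset)
  have "continuous_on (closure \<Omega>) (\<lambda>x. H (v x))"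
    by (rule continuous_on_compose2[OF DERIV_continuous_on[OF H] cont]) (use I in auto)
  moreover have "div_grad_eq_0 \<Omega> k' (\<lambda>x. H (v x))"
  proof (rule div_grad_eq_0I[OF op C1_on_scaleR[OF g(3), of m]])
    show "divergence (\<lambda>x. m *\<^sub>R k x *\<^sub>R g x) x = 0" if "x \<in> \<Omega>" for x
      using divergence_scaleR[OF C1_on_imp_differentiable[OF g(3) op that], of m] g(4)[OF that] by simp
    show "GDERIV (\<lambda>x. H (v x)) x :> h (v x) *\<^sub>R g x" if "x \<in> \<Omega>" for x
      by (rule GDERIV_compose_within[OF op that g(1)[OF that] I' H]) (use I' that in auto)
    show "continuous_on \<Omega> (\<lambda>x. h (v x) *\<^sub>R g x)"
      by (intro continuous_intros g(2) continuous_on_compose2[OF h vc I'])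
    show "k' x *\<^sub>R h (v x) *\<^sub>R g x = m *\<^sub>R k x *\<^sub>R g x" if "x \<in> \<Omega>" for x
      using flux[OF that] by simp
  qed
  moreover have "has_normal_derivative (\<lambda>x. H (v x)) x (n x) 0" if "x \<in> \<Gamma>3" for x
    by (rule has_normal_derivative_0_compose_on[OF dom that _ H I'])
       (use sol I \<open>\<Gamma>3 \<subseteq> closure \<Omega>\<close> that in \<open>auto simp: mixed_solution_def\<close>)
  ultimately show ?thesis using sol by (auto simp: mixed_solution_def)
qed

lemma mixed_solution_affine:
  assumes "mixed_domain \<Omega> \<Gamma>1 \<Gamma>2 \<Gamma>3 n" "mixed_solution \<Omega> \<Gamma>1 \<Gamma>2 \<Gamma>3 n k c1 c2 v"
  shows "mixed_solution \<Omega> \<Gamma>1 \<Gamma>2 \<Gamma>3 n k (r + s * c1) (r + s * c2) (\<lambda>x. r + s * v x)"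
  by (rule mixed_solution_compose[OF assms, where I=UNIV and h="\<lambda>_. s" and m=s])
     (auto intro!: derivative_eq_intros)

lemma mixed_solution_harmonic:
  assumes "open \<Omega>" "mixed_solution \<Omega> \<Gamma>1 \<Gamma>2 \<Gamma>3 n (\<lambda>x. 1) c1 c2 v"
  shows "\<exists>g. \<forall>x\<in>\<Omega>. GDERIV v x :> g x \<and> g differentiable (at x) \<and> divergence g x = 0"
proof -
  obtain g where "\<forall>x\<in>\<Omega>. GDERIV v x :> g x" "C1_on \<Omega> g" "\<forall>x\<in>\<Omega>. divergence g x = 0"
    using assms(2) by (auto simp: mixed_solution_def div_grad_eq_0_def)
  then show ?thesis using C1_on_imp_differentiable[OF _ assms(1)] by blast
qed

text \<open>Comparison principle: the mixed maximum principle for the difference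
  \<open>v - v'\<close>.\<close>

lemma mixed_solution_le:
  assumes dom: "mixed_domain \<Omega> \<Gamma>1 \<Gamma>2 \<Gamma>3 n"
    and sol: "mixed_solution \<Omega> \<Gamma>1 \<Gamma>2 \<Gamma>3 n (\<lambda>x. 1) c1 c2 v"
      "mixed_solution \<Omega> \<Gamma>1 \<Gamma>2 \<Gamma>3 n (\<lambda>x. 1) d1 d2 v'"
    and "\<Gamma>1 \<noteq> {} \<Longrightarrow> c1 \<le> d1 + m" "\<Gamma>2 \<noteq> {} \<Longrightarrow> c2 \<le> d2 + m" "x \<in> closure \<Omega>"
  shows "v x \<le> v' x + m"
proof -
  have op: "open \<Omega>" using dom by (simp add: mixed_domain_def)
  obtain g where g: "\<And>x. x \<in> \<Omega> \<Longrightarrow> GDERIV v x :> g x" "\<And>x. x \<in> \<Omega> \<Longrightarrow> g differentiable (at x)"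
    "\<And>x. x \<in> \<Omega> \<Longrightarrow> divergence g x = 0" using mixed_solution_harmonic[OF op sol(1)] by blast
  obtain g' where g': "\<And>x. x \<in> \<Omega> \<Longrightarrow> GDERIV v' x :> g' x" "\<And>x. x \<in> \<Omega> \<Longrightarrow> g' differentiable (at x)"
    "\<And>x. x \<in> \<Omega> \<Longrightarrow> divergence g' x = 0" using mixed_solution_harmonic[OF op sol(2)] by blast
  have ng': "(\<lambda>x. (-1) *\<^sub>R g' x) differentiable (at x)" if "x \<in> \<Omega>" for x
    by (rule differentiable_scaleR[OF differentiable_const g'(2)[OF that]])
  have "v x - v' x \<le> m"
  proof (rule mixed_max_principle[OF dom, where v="\<lambda>x. v x - v' x" and g="\<lambda>x. g x + (-1) *\<^sub>R g' x"])
    show "continuous_on (closure \<Omega>) (\<lambda>x. v x - v' x)"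
      using sol by (auto simp: mixed_solution_def intro: continuous_intros)
    show "GDERIV (\<lambda>x. v x - v' x) x :> g x + (-1) *\<^sub>R g' x" if "x \<in> \<Omega>" for x
      using GDERIV_diff[OF g(1)[OF that] g'(1)[OF that]] by simp
    show "(\<lambda>x. g x + (-1) *\<^sub>R g' x) differentiable (at x)" if "x \<in> \<Omega>" for x
      by (rule differentiable_add[OF g(2)[OF that] ng'[OF that]])
    show "divergence (\<lambda>x. g x + (-1) *\<^sub>R g' x) x = 0" if "x \<in> \<Omega>" for x
      unfolding divergence_add[OF g(2)[OF that] ng'[OF that]] divergence_scaleR[OF g'(2)[OF that]]
      using g(3) g'(3) that by simp
    show "has_normal_derivative (\<lambda>x. v x - v' x) x (n x) 0" if "x \<in> \<Gamma>3" for x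
    proof -
      have "has_normal_derivative v x (n x) 0" "has_normal_derivative v' x (n x) 0"
        using sol that by (auto simp: mixed_solution_def)
      from DERIV_diff[OF this[unfolded has_normal_derivative_def]]
      show ?thesis by (simp add: has_normal_derivative_def)
    qed
    show "v x - v' x \<le> m" if "x \<in> \<Gamma>1 \<union> \<Gamma>2" for x
    proof (cases "x \<in> \<Gamma>1")
      case True
      then have "v x = c1" "v' x = d1" "\<Gamma>1 \<noteq> {}" using sol by (auto simp: mixed_solution_def)
      then show ?thesis using assms(4) by simp
    next
      case False
      then have "x \<in> \<Gamma>2" using that by simp
      then have "v x = c2" "v' x = d2" "\<Gamma>2 \<noteq> {}" using sol by (auto simp: mixed_solution_def)
      then show ?thesis using assms(5) by simp
    qed
  qed fact
  then show ?thesis by simp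
qed

lemma mixed_solution_unique:
  assumes "mixed_domain \<Omega> \<Gamma>1 \<Gamma>2 \<Gamma>3 n"
    and "mixed_solution \<Omega> \<Gamma>1 \<Gamma>2 \<Gamma>3 n (\<lambda>x. 1) c1 c2 v" "mixed_solution \<Omega> \<Gamma>1 \<Gamma>2 \<Gamma>3 n (\<lambda>x. 1) c1 c2 v'"
    and "x \<in> closure \<Omega>"
  shows "v x = v' x"
  using mixed_solution_le[OF assms(1,2,3), of 0] mixed_solution_le[OF assms(1,3,2), of 0] assms(4)
  by force

text \<open>If a harmonic function omits the value \<open>t\<close>, replacing it by the constant \<open>m\<close> where it exceeds
  \<open>t\<close> keeps it harmonic, and the maximum principle applies to the truncation.\<close>

lemma mixed_solution_gap:
  assumes dom: "mixed_domain \<Omega> \<Gamma>1 \<Gamma>2 \<Gamma>3 n"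
    and sol: "mixed_solution \<Omega> \<Gamma>1 \<Gamma>2 \<Gamma>3 n (\<lambda>x. 1) c1 c2 v"
    and gap: "\<And>x. x \<in> closure \<Omega> \<Longrightarrow> v x \<noteq> t"
    and c: "c1 \<le> m \<or> t < c1" "c2 \<le> m \<or> t < c2"
    and x: "x \<in> closure \<Omega>" "v x < t"
  shows "v x \<le> m"
proof -
  have op: "open \<Omega>" and sub: "\<Gamma>3 \<subseteq> closure \<Omega>"
    using dom by (auto simp: mixed_domain_def frontier_def)
  have subcl: "\<Omega> \<subseteq> closure \<Omega>" by (rule closure_subset)
  obtain g where g: "\<And>x. x \<in> \<Omega> \<Longrightarrow> GDERIV v x :> g x" "\<And>x. x \<in> \<Omega> \<Longrightarrow> g differentiable (at x)"
    "\<And>x. x \<in> \<Omega> \<Longrightarrow> divergence g x = 0" using mixed_solution_harmonic[OF op sol] by blast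
  have cont: "continuous_on (closure \<Omega>) v" using sol by (simp add: mixed_solution_def)
  then have cont\<Omega>: "continuous_on \<Omega> v" using subcl by (rule continuous_on_subset)
  define H where "H s = (if s < t then s else m)" for s
  define h where "h s = (if s < t then 1 else 0 :: real)" for s
  have H: "(H has_real_derivative h s) (at s within - {t})" if "s \<in> - {t}" for s
  proof (cases "s < t")
    case True
    have "(H has_real_derivative 1) (at s)"
      by (rule has_field_derivative_transform_within_open[OF DERIV_ident, where S="{..<t}"])
         (use True in \<open>auto simp: H_def\<close>)
    then show ?thesis using True by (simp add: h_def has_field_derivative_at_within)
  next
    case False
    have "(H has_real_derivative 0) (at s)"
      by (rule has_field_derivative_transform_within_open[OF DERIV_const, where S="{t<..}"])
         (use False that in \<open>auto simp: H_def\<close>)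
    then show ?thesis using False by (simp add: h_def has_field_derivative_at_within)
  qed
  have img: "v ` \<Omega> \<subseteq> - {t}" using gap subcl by blast
  have "open {x \<in> \<Omega>. v x < t}" "open {x \<in> \<Omega>. t < v x}"
    using continuous_open_preimage[OF cont\<Omega> op, of "{..<t}"]
      continuous_open_preimage[OF cont\<Omega> op, of "{t<..}"] by (simp_all add: vimage_def Int_def)
  note opens = this
  \<comment> \<open>Since \<open>v\<close> omits \<open>t\<close>, the open sets
    \<open>{v < t}\<close> and \<open>{v > t}\<close> cover \<open>\<Omega>\<close>; the field
    equals \<open>g\<close> on the first and zero on the second.\<close>
  have g': "(\<lambda>x. h (v x) *\<^sub>R g x) differentiable (at x) \<and> divergence (\<lambda>x. h (v x) *\<^sub>R g x) x = 0"
    if x: "x \<in> \<Omega>" for x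
  proof (cases "v x < t")
    case True
    then have "x \<in> {x \<in> \<Omega>. v x < t}" using x by simp
    from divergence_cong[OF g(2)[OF x] opens(1) this, of "\<lambda>x. h (v x) *\<^sub>R g x"] g(3)[OF x]
    show ?thesis by (simp add: h_def)
  next
    case False
    then have "x \<in> {x \<in> \<Omega>. t < v x}" using x gap[of x] subcl by force
    from divergence_cong[OF differentiable_const opens(2) this, of 0 "\<lambda>x. h (v x) *\<^sub>R g x"]
      divergence_eq[OF has_derivative_const, of 0 x]
    show ?thesis by (simp add: h_def)
  qed
  have "H (v x) \<le> m"
  proof (rule mixed_max_principle[OF dom, where g="\<lambda>x. h (v x) *\<^sub>R g x"])
    show "continuous_on (closure \<Omega>) (\<lambda>x. H (v x))"
      by (rule continuous_on_compose2[OF DERIV_continuous_on[OF H] cont]) (use gap in auto)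
    show "GDERIV (\<lambda>x. H (v x)) x :> h (v x) *\<^sub>R g x" if "x \<in> \<Omega>" for x
      by (rule GDERIV_compose_within[OF op that g(1)[OF that] img H]) (use img that in auto)
    show "has_normal_derivative (\<lambda>x. H (v x)) x (n x) 0" if "x \<in> \<Gamma>3" for x
      by (rule has_normal_derivative_0_compose_on[OF dom that _ H img])
         (use sol gap sub that in \<open>auto simp: mixed_solution_def\<close>)
    show "H (v x) \<le> m" if "x \<in> \<Gamma>1 \<union> \<Gamma>2" for x
      using that sol c by (auto simp: mixed_solution_def H_def)
  qed (use g' x in auto)
  then show ?thesis using x by (simp add: H_def)
qed

section \<open>Functional solutions\<close>

lemma primitive_pos_strict_mono:
  fixes \<beta> :: "real \<Rightarrow> real"
  assumes cont: "continuous_on {a..b} \<beta>" and pos: "\<And>s. s \<in> {a..b} \<Longrightarrow> 0 < \<beta> s"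
    and "a \<le> s" "s < t" "t \<le> b"
  shows "integral {a..s} \<beta> < integral {a..t} \<beta>"
proof (rule DERIV_pos_imp_increasing_open[OF \<open>s < t\<close>, where f="\<lambda>t. integral {a..t} \<beta>"])
  show "\<exists>y. ((\<lambda>t. integral {a..t} \<beta>) has_real_derivative y) (at x) \<and> 0 < y" if "s < x" "x < t" for x
  proof -
    have x: "x \<in> {a..b}" "x \<in> interior {a..b}" using that assms(3,5) by auto
    have "((\<lambda>t. integral {a..t} \<beta>) has_real_derivative \<beta> x) (at x)"
      using integral_has_real_derivative[OF cont x(1)] unfolding at_within_interior[OF x(2)] .
    then show ?thesis using pos[OF x(1)] by blast
  qed
  show "continuous_on {s..t} (\<lambda>t. integral {a..t} \<beta>)"
    by (rule continuous_on_subset[OF DERIV_continuous_on[OF integral_has_real_derivative[OF cont]]])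
       (use assms(3,5) in auto)
qed

text \<open>The primitive is a strictly increasing continuous bijection of a compact interval onto
  \<open>{0..integral {a..b} \<beta>}\<close>, so its inverse is continuous, and the inverse
  function rule within the image also covers the end points.\<close>

lemma primitive_pos_inverse:
  fixes \<beta> :: "real \<Rightarrow> real"
  assumes "a \<le> b" and cont: "continuous_on {a..b} \<beta>" and pos: "\<And>s. s \<in> {a..b} \<Longrightarrow> 0 < \<beta> s"
  obtains J where "\<And>t. t \<in> {a..b} \<Longrightarrow> J (integral {a..t} \<beta>) = t"
    "\<And>y. y \<in> {0..integral {a..b} \<beta>} \<Longrightarrow> J y \<in> {a..b}"
    "\<And>y. y \<in> {0..integral {a..b} \<beta>} \<Longrightarrow> integral {a..J y} \<beta> = y"
    "\<And>y. y \<in> {0..integral {a..b} \<beta>} \<Longrightarrow>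
       (J has_real_derivative 1 / \<beta> (J y)) (at y within {0..integral {a..b} \<beta>})"
proof -
  define G where "G t = integral {a..t} \<beta>" for t
  have G': "(G has_real_derivative \<beta> t) (at t within {a..b})" if "t \<in> {a..b}" for t
    unfolding G_def[abs_def] by (rule integral_has_real_derivative[OF cont that])
  have contG: "continuous_on {a..b} G" by (rule DERIV_continuous_on[OF G'])
  have mono: "G s < G t" if "a \<le> s" "s < t" "t \<le> b" for s t
    unfolding G_def by (rule primitive_pos_strict_mono[OF cont pos that])
  have inj: "inj_on G {a..b}"
  proof (rule inj_onI)
    fix x y assume "x \<in> {a..b}" "y \<in> {a..b}" "G x = G y"
    then show "x = y" using mono[of x y] mono[of y x] by (cases x y rule: linorder_cases) auto
  qed
  have Ga: "G a = 0" by (simp add: G_def)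
  have image: "G ` {a..b} = {0..G b}"
  proof
    show "G ` {a..b} \<subseteq> {0..G b}"
      using mono Ga by (force simp: le_less)
    show "{0..G b} \<subseteq> G ` {a..b}"
      using IVT'[of G a _ b] Ga contG \<open>a \<le> b\<close> by fastforce
  qed
  define J where "J = the_inv_into {a..b} G"
  have JG: "J (G t) = t" if "t \<in> {a..b}" for t
    unfolding J_def by (rule the_inv_into_f_f[OF inj that])
  have J: "J y \<in> {a..b}" "G (J y) = y" if "y \<in> {0..G b}" for y
    using that unfolding image[symmetric] by (auto simp: JG)
  have contJ: "continuous_on (G ` {a..b}) J"
    by (rule continuous_on_inv[OF contG]) (use JG in auto)
  have "(J has_real_derivative 1 / \<beta> (J y)) (at y within {0..G b})" if y: "y \<in> {0..G b}" for y
  proof -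
    have "(J has_derivative (*) (1 / \<beta> (J y))) (at (G (J y)) within G ` {a..b})"
    proof (rule has_derivative_inverse_within)
      show "(G has_derivative (*) (\<beta> (J y))) (at (J y) within {a..b})"
        using G'[OF J(1)[OF y]] by (simp add: has_field_derivative_def)
      show "continuous (at (G (J y)) within G ` {a..b}) J"
        using contJ y J by (simp add: continuous_on_eq_continuous_within image)
      show "linear ((*) (1 / \<beta> (J y)))" by (rule linear_times)
      show "(*) (1 / \<beta> (J y)) \<circ> (*) (\<beta> (J y)) = id"
        using pos[OF J(1)[OF y]] by (auto simp: fun_eq_iff)
    qed (use J y JG in auto)
    then show ?thesis by (simp add: has_field_derivative_def J(2)[OF y] image)
  qed
  then show ?thesis using that[of J] JG J unfolding G_def by blast
qed

lemma continuous_on_graph: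
  assumes "continuous_on (A \<times> B) (\<lambda>(u, w). f u w)" "continuous_on B c" "\<And>t. t \<in> B \<Longrightarrow> c t \<in> A"
  shows "continuous_on B (\<lambda>t. f (c t) t)"
proof -
  have "continuous_on B (\<lambda>t. (c t, t))" by (intro continuous_intros assms(2))
  from continuous_on_compose2[OF assms(1) this] assms(3) show ?thesis by auto
qed

text \<open>Take \<open>w = J (L * z)\<close>, with \<open>J\<close> the inverse of the primitive of
  \<open>b(U(t),t)\<close>. Then \<open>b\<close> times the gradient of \<open>w\<close> is the
  harmonic flux of \<open>L * z\<close>, and the equation for \<open>U\<close> makes the flux of
  \<open>U(w)\<close> equal to \<open>\<gamma>\<close> times it.\<close>

lemma functional_solution_from_two_point_solution:
  assumes dom: "mixed_domain \<Omega> \<Gamma>1 \<Gamma>2 \<Gamma>3 n"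
    and z: "mixed_solution \<Omega> \<Gamma>1 \<Gamma>2 \<Gamma>3 n (\<lambda>x. 1) 0 1 z"
    and w12: "w1 < w2"
    and a_cont: "continuous_on ({u1..u2} \<times> {w1..w2}) (\<lambda>(u, w). a u w)"
    and b_cont: "continuous_on ({u1..u2} \<times> {w1..w2}) (\<lambda>(u, w). b u w)"
    and a_pos: "\<forall>(u, w) \<in> {u1..u2} \<times> {w1..w2}. a u w > 0"
    and b_pos: "\<forall>(u, w) \<in> {u1..u2} \<times> {w1..w2}. b u w > 0"
    and U_sol: "two_point_solution a b u1 u2 w1 w2 \<gamma> U"
  obtains w where "functional_solution \<Omega> \<Gamma>1 \<Gamma>2 \<Gamma>3 n a b u1 u2 w1 w2 (\<lambda>x. U (w x)) w"
proof -
  have UR: "U t \<in> {u1..u2}" if "t \<in> {w1..w2}" for t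
    using U_sol that by (auto simp: two_point_solution_def)
  have U': "(U has_real_derivative \<gamma> * (b (U t) t / a (U t) t)) (at t within {w1..w2})"
    if "t \<in> {w1..w2}" for t using U_sol that by (auto simp: two_point_solution_def)
  have Ue: "U w1 = u1" "U w2 = u2" using U_sol by (auto simp: two_point_solution_def)
  have contU: "continuous_on {w1..w2} U" by (rule DERIV_continuous_on[OF U'])
  define \<beta> where "\<beta> t = b (U t) t" for t
  define \<alpha> where "\<alpha> t = a (U t) t" for t
  have cont: "continuous_on {w1..w2} \<beta>" "continuous_on {w1..w2} \<alpha>"
    using continuous_on_graph[OF b_cont contU UR] continuous_on_graph[OF a_cont contU UR]
    by (simp_all add: \<alpha>_def[abs_def] \<beta>_def[abs_def])
  have pos: "0 < \<beta> t" "0 < \<alpha> t" if "t \<in> {w1..w2}" for t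
    using a_pos b_pos UR[OF that] that by (auto simp: \<alpha>_def \<beta>_def)
  define L where "L = integral {w1..w2} \<beta>"
  obtain J where J: "\<And>t. t \<in> {w1..w2} \<Longrightarrow> J (integral {w1..t} \<beta>) = t"
    "\<And>y. y \<in> {0..L} \<Longrightarrow> J y \<in> {w1..w2}" "\<And>y. y \<in> {0..L} \<Longrightarrow> integral {w1..J y} \<beta> = y"
    "\<And>y. y \<in> {0..L} \<Longrightarrow> (J has_real_derivative 1 / \<beta> (J y)) (at y within {0..L})"
    unfolding L_def
    using primitive_pos_inverse[OF less_imp_le[OF w12] cont(1) pos(1)] by blast
  have J0: "J 0 = w1" "J L = w2" using J(1)[of w1] J(1)[of w2] w12 by (auto simp: L_def)
  have zero: "mixed_solution \<Omega> \<Gamma>1 \<Gamma>2 \<Gamma>3 n (\<lambda>x. 1) 0 0 (\<lambda>x. 0 + 0 * z x)"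
    using mixed_solution_affine[OF dom z, of 0 0] by simp
  \<comment> \<open>Comparison with the zero solution, needed to stay in the domain
    \<open>{0..L}\<close> of \<open>J\<close>.\<close>
  have z01: "0 \<le> z x" "z x \<le> 1" if "x \<in> closure \<Omega>" for x
    using mixed_solution_le[OF dom zero z, of 0 x] mixed_solution_le[OF dom z zero, of 1 x] that
    by simp_all
  define v where "v x = L * z x" for x
  have v_sol: "mixed_solution \<Omega> \<Gamma>1 \<Gamma>2 \<Gamma>3 n (\<lambda>x. 1) 0 L v"
    using mixed_solution_affine[OF dom z, of 0 L] by (simp add: v_def[abs_def])
  have L: "0 \<le> L" unfolding L_def
    by (rule integral_nonneg[OF integrable_continuous_real[OF cont(1)]]) (use pos(1) in force)
  have vI: "v x \<in> {0..L}" if "x \<in> closure \<Omega>" for x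
    using z01[OF that] L by (auto simp: v_def mult_left_le)
  have w_sol: "mixed_solution \<Omega> \<Gamma>1 \<Gamma>2 \<Gamma>3 n (\<lambda>x. b (U (J (v x))) (J (v x))) (J 0) (J L) (\<lambda>x. J (v x))"
  proof (rule mixed_solution_compose[OF dom v_sol vI J(4), where m=1])
    show "continuous_on {0..L} (\<lambda>y. 1 / \<beta> (J y))"
      by (intro continuous_intros continuous_on_compose2[OF cont(1) DERIV_continuous_on[OF J(4)]])
         (use J(2) pos(1) in \<open>auto simp: less_imp_neq[symmetric]\<close>)
    show "b (U (J (v x))) (J (v x)) * (1 / \<beta> (J (v x))) = 1 * 1" if "x \<in> \<Omega>" for x
      using pos(1)[OF J(2)[OF vI]] that closure_subset by (fastforce simp: \<beta>_def)
  qed auto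
  have wI: "J (v x) \<in> {w1..w2}" if "x \<in> closure \<Omega>" for x by (rule J(2)[OF vI[OF that]])
  have U'': "(U has_real_derivative \<gamma> * (\<beta> t / \<alpha> t)) (at t within {w1..w2})"
    if "t \<in> {w1..w2}" for t using U'[OF that] by (simp add: \<alpha>_def \<beta>_def)
  have cU': "continuous_on {w1..w2} (\<lambda>t. \<gamma> * (\<beta> t / \<alpha> t))"
    by (intro continuous_intros cont) (use pos(2) in force)
  have u_sol: "mixed_solution \<Omega> \<Gamma>1 \<Gamma>2 \<Gamma>3 n (\<lambda>x. a (U (J (v x))) (J (v x))) (U (J 0)) (U (J L))
      (\<lambda>x. U (J (v x)))"
  proof (rule mixed_solution_compose[OF dom w_sol wI U'' cU', where m=\<gamma>])
    show "a (U (J (v x))) (J (v x)) * (\<gamma> * (\<beta> (J (v x)) / \<alpha> (J (v x)))) = \<gamma> * b (U (J (v x))) (J (v x))"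
      if "x \<in> \<Omega>" for x
      using pos(2)[OF wI] that closure_subset by (fastforce simp: \<alpha>_def \<beta>_def)
  qed auto
  have "C1_on {w1..w2} U"
    unfolding C1_on_def
  proof (intro exI conjI ballI)
    show "(U has_derivative blinfun_apply (blinfun_mult_right (\<gamma> * (\<beta> t / \<alpha> t)))) (at t within {w1..w2})"
      if "t \<in> {w1..w2}" for t using U''[OF that] by (simp add: has_field_derivative_def)
    show "continuous_on {w1..w2} (\<lambda>t. blinfun_mult_right (\<gamma> * (\<beta> t / \<alpha> t)))"
      by (intro bounded_linear.continuous_on[OF bounded_linear_blinfun_mult_right] cU')
  qed
  then have "functional_solution \<Omega> \<Gamma>1 \<Gamma>2 \<Gamma>3 n a b u1 u2 w1 w2 (\<lambda>x. U (J (v x))) (\<lambda>x. J (v x))"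
    using u_sol w_sol wI UR by (auto simp: functional_solution_def classical_solution_def J0 Ue)
  then show ?thesis by (rule that)
qed

lemma C1_on_realE:
  fixes V :: "real \<Rightarrow> real"
  assumes "C1_on I V"
  obtains V' where "\<And>t. t \<in> I \<Longrightarrow> (V has_real_derivative V' t) (at t within I)" "continuous_on I V'"
proof -
  obtain F where F: "\<And>t. t \<in> I \<Longrightarrow> (V has_derivative blinfun_apply (F t)) (at t within I)"
    "continuous_on I F"
    using assms unfolding C1_on_def by blast
  show ?thesis
  proof (rule that)
    show "(V has_real_derivative blinfun_apply (F t) 1) (at t within I)" if "t \<in> I" for t
      by (rule has_derivative_imp_has_field_derivative[OF F(1)[OF that]])
         (metis blinfun.scaleR_right mult.right_neutral real_scaleR_def)
    show "continuous_on I (\<lambda>t. blinfun_apply (F t) 1)"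
      by (intro continuous_intros F(2))
  qed
qed

text \<open>Outside the range of \<open>w\<close> the values of \<open>V\<close> need not lie in \<open>{u1..u2}\<close>, so in the proof \<open>V\<close> is
  clamped to this interval inside the coefficients.\<close>

lemma functional_solution_determined:
  assumes dom: "mixed_domain \<Omega> \<Gamma>1 \<Gamma>2 \<Gamma>3 n"
    and z: "mixed_solution \<Omega> \<Gamma>1 \<Gamma>2 \<Gamma>3 n (\<lambda>x. 1) 0 1 z"
    and w12: "w1 < w2" and u12: "u1 \<le> u2"
    and a_cont: "continuous_on ({u1..u2} \<times> {w1..w2}) (\<lambda>(u, w). a u w)"
    and b_cont: "continuous_on ({u1..u2} \<times> {w1..w2}) (\<lambda>(u, w). b u w)"
    and a_pos: "\<forall>(u, w) \<in> {u1..u2} \<times> {w1..w2}. a u w > 0"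
    and b_pos: "\<forall>(u, w) \<in> {u1..u2} \<times> {w1..w2}. b u w > 0"
    and sol: "functional_solution \<Omega> \<Gamma>1 \<Gamma>2 \<Gamma>3 n a b u1 u2 w1 w2 u w"
  shows "(\<forall>x\<in>closure \<Omega>. z x = 0 \<and> u x = u1 \<and> w x = w1 \<or> z x = 1 \<and> u x = u2 \<and> w x = w2) \<or>
    (\<exists>\<gamma> V. two_point_solution a b u1 u2 w1 w2 \<gamma> V \<and>
       (\<forall>x\<in>closure \<Omega>. w x \<in> {w1..w2} \<and> u x = V (w x) \<and>
          integral {w1..w x} (\<lambda>t. b (V t) t) = integral {w1..w2} (\<lambda>t. b (V t) t) * z x))"
proof -
  have op: "open \<Omega>" and subcl: "\<Omega> \<subseteq> closure \<Omega>"
    and \<Gamma>cl: "\<Gamma>1 \<subseteq> closure \<Omega>" "\<Gamma>2 \<subseteq> closure \<Omega>" "\<Gamma>3 \<subseteq> closure \<Omega>"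
    using dom closure_subset by (auto simp: mixed_domain_def frontier_def)
  obtain V where "C1_on {w1..w2} V" and uV: "\<And>x. x \<in> closure \<Omega> \<Longrightarrow> u x = V (w x)"
    using sol by (auto simp: functional_solution_def)
  obtain V' where V': "\<And>t. t \<in> {w1..w2} \<Longrightarrow> (V has_real_derivative V' t) (at t within {w1..w2})"
    and cV': "continuous_on {w1..w2} V'" using C1_on_realE[OF \<open>C1_on {w1..w2} V\<close>] by blast
  have cV: "continuous_on {w1..w2} V" by (rule DERIV_continuous_on[OF V'])
  have uI: "u x \<in> {u1..u2}" and wI: "w x \<in> {w1..w2}" if "x \<in> closure \<Omega>" for x
    using sol that by (auto simp: functional_solution_def classical_solution_def)
  have u_sol: "mixed_solution \<Omega> \<Gamma>1 \<Gamma>2 \<Gamma>3 n (\<lambda>x. a (u x) (w x)) u1 u2 u"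
    and w_sol: "mixed_solution \<Omega> \<Gamma>1 \<Gamma>2 \<Gamma>3 n (\<lambda>x. b (u x) (w x)) w1 w2 w"
    using sol by (auto simp: functional_solution_def classical_solution_def)
  define c where "c t = max u1 (min u2 (V t))" for t
  have cI: "c t \<in> {u1..u2}" for t using u12 by (auto simp: c_def)
  have c_eq: "c t = V t" if "V t \<in> {u1..u2}" for t using that by (auto simp: c_def)
  have cw: "c (w x) = u x" if "x \<in> closure \<Omega>" for x
    using c_eq[of "w x"] uI[OF that] uV[OF that] by simp
  define \<beta> where "\<beta> t = b (c t) t" for t
  define \<alpha> where "\<alpha> t = a (c t) t" for t
  have cc: "continuous_on {w1..w2} c" unfolding c_def[abs_def] by (intro continuous_intros cV)
  have cont: "continuous_on {w1..w2} \<beta>" "continuous_on {w1..w2} \<alpha>"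
    using continuous_on_graph[OF b_cont cc cI] continuous_on_graph[OF a_cont cc cI]
    by (simp_all add: \<alpha>_def[abs_def] \<beta>_def[abs_def])
  have pos: "0 < \<beta> t" "0 < \<alpha> t" if "t \<in> {w1..w2}" for t
    using a_pos b_pos cI[of t] that by (auto simp: \<alpha>_def \<beta>_def)
  have caV: "continuous_on {w1..w2} (\<lambda>t. \<alpha> t * V' t)" by (intro continuous_intros cont cV')
  \<comment> \<open>\<open>G\<close> and \<open>F\<close> are chosen so that the gradients of
    \<open>G(w)\<close> and \<open>F(w)\<close> are the fluxes of the \<open>w\<close> equation and
    of the \<open>u\<close> equation.\<close>
  define G where "G t = integral {w1..t} \<beta>" for t
  define F where "F t = integral {w1..t} (\<lambda>t. \<alpha> t * V' t)" for t
  have G': "(G has_real_derivative \<beta> t) (at t within {w1..w2})" if "t \<in> {w1..w2}" for t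
    unfolding G_def[abs_def] by (rule integral_has_real_derivative[OF cont(1) that])
  have F': "(F has_real_derivative \<alpha> t * V' t) (at t within {w1..w2})" if "t \<in> {w1..w2}" for t
    unfolding F_def[abs_def] by (rule integral_has_real_derivative[OF caV that])
  have GF1: "G w1 = 0" "F w1 = 0" by (simp_all add: G_def F_def)
  have G_mono: "G s < G t" if "w1 \<le> s" "s < t" "t \<le> w2" for s t
    unfolding G_def by (rule primitive_pos_strict_mono[OF cont(1) pos(1) that])
  have G_inj: "s = t" if "s \<in> {w1..w2}" "t \<in> {w1..w2}" "G s = G t" for s t
    using that G_mono[of s t] G_mono[of t s] by (cases s t rule: linorder_cases) auto
  have G2: "0 < G w2" using G_mono[of w1 w2] w12 GF1 by simp

  have "mixed_solution \<Omega> \<Gamma>1 \<Gamma>2 \<Gamma>3 n (\<lambda>x. 1) (G w1) (G w2) (\<lambda>x. G (w x))"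
    by (rule mixed_solution_compose[OF dom w_sol wI G' cont(1), where m=1])
       (use cw subcl in \<open>auto simp: \<beta>_def\<close>)
  moreover have z_scaled: "mixed_solution \<Omega> \<Gamma>1 \<Gamma>2 \<Gamma>3 n (\<lambda>x. 1) 0 r (\<lambda>x. r * z x)" for r
    using mixed_solution_affine[OF dom z, of 0 r] by simp
  ultimately have Gw: "G (w x) = G w2 * z x" if "x \<in> closure \<Omega>" for x
    using mixed_solution_unique[OF dom _ _ that] GF1 by metis

  \<comment> \<open>\<open>mixed_solution_compose\<close> does not apply: the gradient of
    \<open>F(w)\<close> is the flux of \<open>u\<close>, not yet known to be a multiple of that of
    \<open>w\<close>. Harmonicity comes from the equation for \<open>u\<close>, boundary behaviour
    from \<open>w\<close>.\<close>
  have "mixed_solution \<Omega> \<Gamma>1 \<Gamma>2 \<Gamma>3 n (\<lambda>x. 1) (F w1) (F w2) (\<lambda>x. F (w x))"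
  proof -
    have w\<Omega>: "w ` \<Omega> \<subseteq> {w1..w2}" using wI subcl by blast
    have "continuous_on (closure \<Omega>) (\<lambda>x. F (w x))"
      by (rule continuous_on_compose2[OF DERIV_continuous_on[OF F']])
         (use w_sol wI in \<open>auto simp: mixed_solution_def\<close>)
    moreover have "div_grad_eq_0 \<Omega> (\<lambda>x. 1) (\<lambda>x. F (w x))"
    proof -
      obtain g where g: "\<And>x. x \<in> \<Omega> \<Longrightarrow> GDERIV u x :> g x" "C1_on \<Omega> (\<lambda>x. a (u x) (w x) *\<^sub>R g x)"
        "\<And>x. x \<in> \<Omega> \<Longrightarrow> divergence (\<lambda>x. a (u x) (w x) *\<^sub>R g x) x = 0"
        using u_sol unfolding mixed_solution_def div_grad_eq_0_def by blast
      obtain gw where gw: "\<And>x. x \<in> \<Omega> \<Longrightarrow> GDERIV w x :> gw x"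
        using w_sol unfolding mixed_solution_def div_grad_eq_0_def by blast
      have g_eq: "g x = V' (w x) *\<^sub>R gw x" if x: "x \<in> \<Omega>" for x
      proof -
        have "GDERIV (\<lambda>x. V (w x)) x :> V' (w x) *\<^sub>R gw x"
          by (rule GDERIV_compose_within[OF op x gw[OF x] w\<Omega> V']) (use w\<Omega> x in auto)
        then have "GDERIV u x :> V' (w x) *\<^sub>R gw x"
          unfolding gderiv_def
          by (rule has_derivative_transform_within_open[OF _ op x]) (use uV subcl in auto)
        then have "(\<lambda>h. h \<bullet> g x) = (\<lambda>h. h \<bullet> (V' (w x) *\<^sub>R gw x))"
          unfolding gderiv_def by (rule has_derivative_unique[OF g(1)[OF x, unfolded gderiv_def]])
        then show ?thesis by (simp only: fun_eq_iff vector_eq_ldot)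
      qed
      show ?thesis
      proof (rule div_grad_eq_0I[OF op g(2,3)])
        show "GDERIV (\<lambda>x. F (w x)) x :> a (u x) (w x) *\<^sub>R g x" if x: "x \<in> \<Omega>" for x
        proof -
          have "GDERIV (\<lambda>x. F (w x)) x :> (\<alpha> (w x) * V' (w x)) *\<^sub>R gw x"
            by (rule GDERIV_compose_within[OF op x gw[OF x] w\<Omega> F']) (use w\<Omega> x in auto)
          moreover have "\<alpha> (w x) = a (u x) (w x)" using cw[of x] subcl x by (auto simp: \<alpha>_def)
          ultimately show ?thesis by (simp add: g_eq[OF x])
        qed
        show "continuous_on \<Omega> (\<lambda>x. a (u x) (w x) *\<^sub>R g x)"
          using C1_on_imp_differentiable[OF g(2) op] differentiable_imp_continuous_within
          by (intro continuous_at_imp_continuous_on) blast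
        show "1 *\<^sub>R a (u x) (w x) *\<^sub>R g x = a (u x) (w x) *\<^sub>R g x" for x
          by (rule scaleR_one)
      qed
    qed
    moreover have "has_normal_derivative (\<lambda>x. F (w x)) x (n x) 0" if "x \<in> \<Gamma>3" for x
      by (rule has_normal_derivative_0_compose_on[OF dom that _ F' w\<Omega>])
         (use w_sol wI \<Gamma>cl(3) that in \<open>auto simp: mixed_solution_def\<close>)
    ultimately show ?thesis using w_sol by (auto simp: mixed_solution_def)
  qed
  then have Fw: "F (w x) = F w2 * z x" if "x \<in> closure \<Omega>" for x
    using mixed_solution_unique[OF dom _ z_scaled that] GF1 by metis

  \<comment> \<open>With \<open>\<Gamma>1\<close> empty the constant 1, written as an affine image
    of \<open>z\<close>, solves the same problem as \<open>z\<close>.\<close>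
  have z1: "z x = 1" if "\<Gamma>1 = {}" "x \<in> closure \<Omega>" for x
    using mixed_solution_unique[OF dom z _ that(2), of "\<lambda>x. 1 + 0 * z x"]
      mixed_solution_affine[OF dom z, of 1 0] z that(1) by (auto simp: mixed_solution_def)
  have z0: "z x = 0" if "\<Gamma>2 = {}" "x \<in> closure \<Omega>" for x
    using mixed_solution_unique[OF dom z _ that(2), of "\<lambda>x. 0 + 0 * z x"]
      mixed_solution_affine[OF dom z, of 0 0] z that(1) by (auto simp: mixed_solution_def)
  have V1: "V w1 = u1" if "\<Gamma>1 \<noteq> {}"
  proof -
    obtain x where "x \<in> \<Gamma>1" using \<open>\<Gamma>1 \<noteq> {}\<close> by blast
    then have "u x = u1" "w x = w1" "x \<in> closure \<Omega>"
      using u_sol w_sol \<Gamma>cl by (auto simp: mixed_solution_def)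
    then show ?thesis using uV[of x] by simp
  qed
  have V2: "V w2 = u2" if "\<Gamma>2 \<noteq> {}"
  proof -
    obtain x where "x \<in> \<Gamma>2" using \<open>\<Gamma>2 \<noteq> {}\<close> by blast
    then have "u x = u2" "w x = w2" "x \<in> closure \<Omega>"
      using u_sol w_sol \<Gamma>cl by (auto simp: mixed_solution_def)
    then show ?thesis using uV[of x] by simp
  qed

  show ?thesis
  proof (cases "{0<..<1} \<subseteq> z ` closure \<Omega>")
    case False
    then obtain s where s: "0 < s" "s < 1" "\<And>x. x \<in> closure \<Omega> \<Longrightarrow> z x \<noteq> s" by force
    \<comment> \<open>The omitted value \<open>s\<close> forces \<open>z \<le> 0\<close> below it,
      and the same argument for \<open>1 - z\<close> forces \<open>z \<ge> 1\<close> above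
      it.\<close>
    have "z x = 0 \<or> z x = 1" if x: "x \<in> closure \<Omega>" for x
    proof -
      have flip: "mixed_solution \<Omega> \<Gamma>1 \<Gamma>2 \<Gamma>3 n (\<lambda>x. 1) 1 0 (\<lambda>x. 1 + (-1) * z x)"
        using mixed_solution_affine[OF dom z, of 1 "-1"] by simp
      have zero: "mixed_solution \<Omega> \<Gamma>1 \<Gamma>2 \<Gamma>3 n (\<lambda>x. 1) 0 0 (\<lambda>x. 0 + 0 * z x)"
        using mixed_solution_affine[OF dom z, of 0 0] by simp
      have "0 \<le> z x" "z x \<le> 1"
        using mixed_solution_le[OF dom zero z, of 0 x] mixed_solution_le[OF dom z zero, of 1 x] x
        by simp_all
      moreover have "z x \<le> 0" if "z x < s"
        by (rule mixed_solution_gap[OF dom z s(3)]) (use s x that in auto)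
      moreover have "1 + (-1) * z x \<le> 0" if "s < z x"
        by (rule mixed_solution_gap[OF dom flip, of "1 - s"]) (use s x that in auto)
      ultimately show ?thesis using s(3)[OF x] by (cases "z x" s rule: linorder_cases) auto
    qed
    moreover have "u x = u1 \<and> w x = w1" if x: "x \<in> closure \<Omega>" "z x = 0" for x
    proof -
      have "w x = w1" using G_inj[OF wI[OF x(1)], of w1] Gw[OF x(1)] x(2) GF1 w12 by simp
      moreover have "\<Gamma>1 \<noteq> {}" using z1 x by force
      ultimately show ?thesis using V1 uV[OF x(1)] by simp
    qed
    moreover have "u x = u2 \<and> w x = w2" if x: "x \<in> closure \<Omega>" "z x = 1" for x
    proof -
      have "w x = w2" using G_inj[OF wI[OF x(1)], of w2] Gw[OF x(1)] x(2) w12 by simp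
      moreover have "\<Gamma>2 \<noteq> {}" using z0 x by force
      ultimately show ?thesis using V2 uV[OF x(1)] by simp
    qed
    ultimately show ?thesis by blast
  next
    case True
    \<comment> \<open>A point with \<open>z = 1 / 2\<close> shows that \<open>z\<close> is neither
      constantly 0 nor constantly 1, so \<open>\<Gamma>1\<close> and \<open>\<Gamma>2\<close> are
      nonempty and both end values of \<open>V\<close> are known.\<close>
    have "1 / 2 \<in> {0<..<1::real}" by simp
    with True obtain x0 where x0: "x0 \<in> closure \<Omega>" "z x0 = 1 / 2" by (metis imageE subsetD)
    have ends: "V w1 = u1" "V w2 = u2"
      using V1 V2 z0[OF _ x0(1)] z1[OF _ x0(1)] x0(2) by auto
    define \<gamma> where "\<gamma> = F w2 / G w2"
    \<comment> \<open>For interior \<open>t\<close> the ratio \<open>G t / G w2\<close> is a value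
      of \<open>z\<close>, so injectivity of \<open>G\<close> gives a point with
      \<open>w x = t\<close>. What holds for \<open>u\<close> and \<open>F(w)\<close> there becomes
      a statement at \<open>t\<close>.\<close>
    have onto: "V t \<in> {u1..u2} \<and> F t = \<gamma> * G t" if t: "t \<in> {w1..w2}" for t
    proof -
      consider "t = w1" | "t = w2" | "w1 < t" "t < w2" using t by force
      then show ?thesis
      proof cases
        case 3
        have "0 < G t" "G t < G w2" using G_mono[of w1 t] G_mono[of t w2] 3 GF1 by auto
        then have "G t / G w2 \<in> {0<..<1}" by simp
        then obtain x where x: "x \<in> closure \<Omega>" "z x = G t / G w2" using True by (auto simp: subset_iff image_iff)
        then have "G (w x) = G t" using Gw[OF x(1)] G2 by simp
        then have "w x = t" by (rule G_inj[OF wI[OF x(1)] t])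
        then show ?thesis
          using uV[OF x(1)] uI[OF x(1)] Fw[OF x(1)] x(2) by (simp add: \<gamma>_def)
      qed (use ends u12 GF1 G2 in \<open>auto simp: \<gamma>_def\<close>)
    qed
    have c_V: "c t = V t" if "t \<in> {w1..w2}" for t using c_eq onto[OF that] by blast
    have "(V has_real_derivative \<gamma> * (b (V t) t / a (V t) t)) (at t within {w1..w2})"
      if t: "t \<in> {w1..w2}" for t
    proof -
      \<comment> \<open>Differentiating \<open>F = \<gamma> G\<close> yields the differential
        equation for \<open>V\<close>.\<close>
      have "((\<lambda>s. \<gamma> * G s) has_real_derivative \<gamma> * \<beta> t) (at t within {w1..w2})"
        by (rule DERIV_cmult[OF G'[OF t]])
      then have "(F has_real_derivative \<gamma> * \<beta> t) (at t within {w1..w2})"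
        by (rule has_field_derivative_transform_within[OF _ zero_less_one t]) (use onto in auto)
      moreover have "at t within {w1..w2} \<noteq> bot"
        using t w12 by (simp add: trivial_limit_within islimpt_Icc)
      ultimately have "\<alpha> t * V' t = \<gamma> * \<beta> t"
        using has_field_derivative_unique[OF F'[OF t]] by blast
      then have "V' t = \<gamma> * (b (V t) t / a (V t) t)"
        using pos(2)[OF t] by (simp add: \<alpha>_def \<beta>_def c_V[OF t] field_simps)
      then show ?thesis using V'[OF t] by simp
    qed
    then have "two_point_solution a b u1 u2 w1 w2 \<gamma> V"
      using onto ends by (auto simp: two_point_solution_def)
    moreover have "integral {w1..t} (\<lambda>t. b (V t) t) = G t" if "t \<in> {w1..w2}" for t
      unfolding G_def by (rule integral_cong) (use that c_V in \<open>auto simp: \<beta>_def\<close>)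
    then have "integral {w1..w x} (\<lambda>t. b (V t) t) = integral {w1..w2} (\<lambda>t. b (V t) t) * z x"
      if "x \<in> closure \<Omega>" for x
      using wI[OF that] Gw[OF that] w12 by simp
    ultimately show ?thesis using wI uV by blast
  qed
qed

theorem theorem2p7:
  fixes \<Omega> \<Gamma>1 \<Gamma>2 \<Gamma>3 :: "(real ^ 'n) set"
    and n :: "real ^ 'n \<Rightarrow> real ^ 'n"
    and a b :: "real \<Rightarrow> real \<Rightarrow> real"
    and u1 u2 w1 w2 \<gamma> :: real
    and U :: "real \<Rightarrow> real"
  assumes domain: "mixed_domain \<Omega> \<Gamma>1 \<Gamma>2 \<Gamma>3 n"
    and solvable: "\<exists>z. mixed_solution \<Omega> \<Gamma>1 \<Gamma>2 \<Gamma>3 n (\<lambda>x. 1) 0 1 z"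
    and w12: "w1 < w2"
    and a_cont: "continuous_on ({u1..u2} \<times> {w1..w2}) (\<lambda>(u, w). a u w)"
    and b_cont: "continuous_on ({u1..u2} \<times> {w1..w2}) (\<lambda>(u, w). b u w)"
    and a_pos: "\<forall>(u, w) \<in> {u1..u2} \<times> {w1..w2}. a u w > 0"
    and b_pos: "\<forall>(u, w) \<in> {u1..u2} \<times> {w1..w2}. b u w > 0"
    and U_sol: "two_point_solution a b u1 u2 w1 w2 \<gamma> U"
    and U_unique: "\<forall>\<gamma>' V. two_point_solution a b u1 u2 w1 w2 \<gamma>' V \<longrightarrow>
                     \<gamma>' = \<gamma> \<and> (\<forall>t\<in>{w1..w2}. V t = U t)"
  shows "\<exists>u w. functional_solution \<Omega> \<Gamma>1 \<Gamma>2 \<Gamma>3 n a b u1 u2 w1 w2 u w \<and>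
           (\<forall>x\<in>closure \<Omega>. u x = U (w x)) \<and>
           (\<forall>u' w'. functional_solution \<Omega> \<Gamma>1 \<Gamma>2 \<Gamma>3 n a b u1 u2 w1 w2 u' w' \<longrightarrow>
              (\<forall>x\<in>closure \<Omega>. u' x = u x \<and> w' x = w x))"
proof -
  obtain z where z: "mixed_solution \<Omega> \<Gamma>1 \<Gamma>2 \<Gamma>3 n (\<lambda>x. 1) 0 1 z" using solvable by blast
  have u12: "u1 \<le> u2" using U_sol w12 by (force simp: two_point_solution_def)
  note determined = functional_solution_determined[OF domain z w12 u12 a_cont b_cont a_pos b_pos]
  obtain w where w: "functional_solution \<Omega> \<Gamma>1 \<Gamma>2 \<Gamma>3 n a b u1 u2 w1 w2 (\<lambda>x. U (w x)) w"
    using functional_solution_from_two_point_solution[OF domain z w12 a_cont b_cont a_pos b_pos U_sol] .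
  let ?G = "\<lambda>t. integral {w1..t} (\<lambda>t. b (U t) t)"
  let ?trivial = "\<lambda>u w x. z x = 0 \<and> u x = u1 \<and> w x = w1 \<or> z x = 1 \<and> u x = u2 \<and> w x = w2"
  let ?determined = "\<lambda>u w x. w x \<in> {w1..w2} \<and> u x = U (w x) \<and> ?G (w x) = ?G w2 * z x"
  have Ue: "U w1 = u1" "U w2 = u2" using U_sol by (auto simp: two_point_solution_def)
  \<comment> \<open>Both alternatives lead to one formula: in the two-valued case it holds because
    \<open>U\<close> has the right end values and \<open>?G w1 = 0\<close>; otherwise
    \<open>U_unique\<close> replaces \<open>V\<close> by \<open>U\<close>.\<close>
  have all: "?determined u' w' x"
    if sol: "functional_solution \<Omega> \<Gamma>1 \<Gamma>2 \<Gamma>3 n a b u1 u2 w1 w2 u' w'" and x: "x \<in> closure \<Omega>" for u' w' x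
    using determined[OF sol]
  proof (elim disjE exE conjE)
    assume "\<forall>x\<in>closure \<Omega>. ?trivial u' w' x"
    then show ?thesis using x Ue w12 by force
  next
    fix \<gamma>' V
    assume V: "two_point_solution a b u1 u2 w1 w2 \<gamma>' V" and eq: "\<forall>x\<in>closure \<Omega>. w' x \<in> {w1..w2} \<and>
      u' x = V (w' x) \<and> integral {w1..w' x} (\<lambda>t. b (V t) t) = integral {w1..w2} (\<lambda>t. b (V t) t) * z x"
    have VU: "V t = U t" if "t \<in> {w1..w2}" for t using U_unique V that by blast
    have "integral {w1..t} (\<lambda>t. b (V t) t) = ?G t" if "t \<in> {w1..w2}" for t
      by (rule integral_cong) (use VU that in auto)
    then show ?thesis using eq x VU w12 by force
  qed
  have UR: "U t \<in> {u1..u2}" if "t \<in> {w1..w2}" for t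
    using U_sol that by (auto simp: two_point_solution_def)
  have "continuous_on {w1..w2} U"
    by (rule DERIV_continuous_on) (use U_sol in \<open>auto simp: two_point_solution_def\<close>)
  then have cont: "continuous_on {w1..w2} (\<lambda>t. b (U t) t)"
    using continuous_on_graph[OF b_cont] UR by blast
  have pos: "0 < b (U t) t" if "t \<in> {w1..w2}" for t using b_pos UR[OF that] that by auto
  \<comment> \<open>Injectivity lets the formula \<open>?G (w x) = ?G w2 * z x\<close> determine
    \<open>w\<close>, and then \<open>u = U(w)\<close>.\<close>
  have inj: "s = t" if "s \<in> {w1..w2}" "t \<in> {w1..w2}" "?G s = ?G t" for s t
    using that primitive_pos_strict_mono[OF cont pos, of s t] primitive_pos_strict_mono[OF cont pos, of t s]
    by (cases s t rule: linorder_cases) auto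
  have "u' x = U (w x) \<and> w' x = w x"
    if "functional_solution \<Omega> \<Gamma>1 \<Gamma>2 \<Gamma>3 n a b u1 u2 w1 w2 u' w'" "x \<in> closure \<Omega>" for u' w' x
    using all[OF that] all[OF w that(2)] inj[of "w' x" "w x"] by auto
  then show ?thesis using w by blast
qed

end
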